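(* Let $(G,d)$ be a group with a two-sided invariant metric, let $A,B\le G$ be closed subgroups and $\phi:A\to B$ a group isomorphism which is a $d$-isometry. Let $H=\langle G,t\mid tat^{-1}=\phi(a),\ a\in A\rangle$ be the (abstract) HNN extension of $(G,\phi)$ with stable letter $t$. If $K>0$ and $\operatorname{diam}_d(A)\le K$, then there is a two-sided invariant metric $\underline d$ on $H$ such that $\underline d|_G=d$ and $\underline d(t,e)=K$.
   Context: $\operatorname{diam}_d(A)=\sup\{d(a_1,a_2):a_1,a_2\in A\}$. A two-sided invariant metric satisfies $d(gf_1,gf_2)=d(f_1,f_2)=d(f_1g,f_2g)$. *)

theory Defs
  imports "HOL-Analysis.Analysis" "HOL-Algebra.Algebra"
begin

definition biinv_metric :: "('a, 'b) monoid_scheme \<Rightarrow> ('a \<Rightarrow> 'a \<Rightarrow> real) \<Rightarrow> bool" where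
  "biinv_metric G d \<longleftrightarrow> Metric_space (carrier G) d \<and>
     (\<forall>g\<in>carrier G. \<forall>f1\<in>carrier G. \<forall>f2\<in>carrier G.
        d (g \<otimes>\<^bsub>G\<^esub> f1) (g \<otimes>\<^bsub>G\<^esub> f2) = d f1 f2 \<and>
        d (f1 \<otimes>\<^bsub>G\<^esub> g) (f2 \<otimes>\<^bsub>G\<^esub> g) = d f1 f2)"

definition diam_d :: "('a \<Rightarrow> 'a \<Rightarrow> real) \<Rightarrow> 'a set \<Rightarrow> ereal" where
  "diam_d d A = (SUP p\<in>A \<times> A. ereal (d (fst p) (snd p)))"

text \<open>(H, iota, t) is the HNN extension of (G, phi) with base subgroup A and stable letter t,
  i.e. H is the group presented by G, t and the relations t a t^-1 = phi a (a in A).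
  It is characterised by: the relations hold, H is generated by iota(G) and t, and every
  assignment to a group satisfying the relations extends to a homomorphism. The targets of
  the universal property are taken with carrier type of words over G + {t, t^-1}
  (type ('a + bool) list set), which is large enough to contain a copy of the presented group.\<close>
definition is_HNN_extension ::
  "'a monoid \<Rightarrow> 'a set \<Rightarrow> ('a \<Rightarrow> 'a) \<Rightarrow> 'h monoid \<Rightarrow> ('a \<Rightarrow> 'h) \<Rightarrow> 'h \<Rightarrow> bool" where
  "is_HNN_extension G A \<phi> H \<iota> t \<longleftrightarrow>
     group H \<and> \<iota> \<in> hom G H \<and> t \<in> carrier H \<and>
     (\<forall>a\<in>A. t \<otimes>\<^bsub>H\<^esub> \<iota> a \<otimes>\<^bsub>H\<^esub> inv\<^bsub>H\<^esub> t = \<iota> (\<phi> a)) \<and>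
     generate H (\<iota> ` carrier G \<union> {t}) = carrier H \<and>
     (\<forall>(K :: ('a + bool) list set monoid) f s.
        group K \<and> f \<in> hom G K \<and> s \<in> carrier K \<and>
        (\<forall>a\<in>A. s \<otimes>\<^bsub>K\<^esub> f a \<otimes>\<^bsub>K\<^esub> inv\<^bsub>K\<^esub> s = f (\<phi> a))
        \<longrightarrow> (\<exists>h \<in> hom H K. (\<forall>g\<in>carrier G. h (\<iota> g) = f g) \<and> h t = s))"

end

theory Submission
  imports Defs
begin

text \<open>
  It suffices to let \<open>H\<close> act on a pseudometric space \<open>X\<close> by isometries such that \<open>g\<close> in \<open>G\<close> moves
  every point by at most \<open>d g 1\<close> and \<open>t\<close> moves every point by at most \<open>K\<close>: then
  \<open>d' h k = (SUP x\<in>X. dist (h x) (k x))\<close> is bi-invariant. The space \<open>X\<close> is a union of \<open>G\<close>-spaces,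
  starting with \<open>G\<close> itself, on which \<open>t\<close> is a partial isometry; alternately the domain and the range
  of \<open>t\<close> are enlarged to the whole current space by adjoining formal points \<open>g t y\<close> (resp.
  \<open>g t\<^sup>-\<^sup>1 y\<close>) at the largest distances compatible with the displacement bounds. The old metric
  survives because a detour through \<open>t\<close> and back costs \<open>2 K\<close>, while \<open>a\<close> and \<open>\<phi> a\<close> differ by at most
  \<open>2 K\<close>. As \<open>A\<close> and \<open>B\<close> are closed, a reduced word containing \<open>t\<close> moves the base point a positive
  distance, so \<open>d'\<close> separates points.
\<close>

section \<open>Pseudometrics\<close>

text \<open>For an isometric action the supremum is left invariant, and right invariant because
  group elements map \<open>X\<close> to itself. The \<open>2 K\<close> bound is unavoidable:
  bi-invariance in \<open>H\<close> gives d(a, t a t^-1) = d(a t, t a), and both \<open>a t\<close>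
  and \<open>t a\<close> lie within \<open>K\<close> of \<open>a\<close>. The hypothesis supplies it
  because \<open>a\<close> and \<open>\<phi> a\<close> are both within \<open>K\<close> of the
  identity. Points that ought to coincide are left at distance zero, not identified, so every stage
  consists of concrete lists. The price is that \<open>H\<close> acts only up to distance zero:
  words act, and the universal property shows that words of equal value act equally. The lower bound
  for a reduced word does not deteriorate with its length: each new distance is an infimum over
  competing routes, and a route costs \<open>K\<close>, or crosses the part where \<open>t\<close>
  was already defined, or compares a coefficient with \<open>A\<close> or \<open>B\<close>. So any
  \<epsilon> survives that is at most \<open>K\<close> and at most the distances from the
  coefficients to those subgroups that do not contain them. For the word \<open>t\<close> this
  allows \<epsilon> = K, hence the exact value at \<open>t\<close>.\<close>

definition pseudometric_on :: "'x set \<Rightarrow> ('x \<Rightarrow> 'x \<Rightarrow> real) \<Rightarrow> bool" where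
  "pseudometric_on S \<rho> \<longleftrightarrow>
     (\<forall>x\<in>S. \<rho> x x = 0) \<and> (\<forall>x\<in>S. \<forall>y\<in>S. \<rho> x y = \<rho> y x) \<and>
     (\<forall>x\<in>S. \<forall>y\<in>S. \<forall>z\<in>S. \<rho> x z \<le> \<rho> x y + \<rho> y z)"

lemma pseudometric_onI:
  assumes "\<And>x. x \<in> S \<Longrightarrow> \<rho> x x = 0"
    and "\<And>x y. x \<in> S \<Longrightarrow> y \<in> S \<Longrightarrow> \<rho> x y = \<rho> y x"
    and "\<And>x y z. x \<in> S \<Longrightarrow> y \<in> S \<Longrightarrow> z \<in> S \<Longrightarrow> \<rho> x z \<le> \<rho> x y + \<rho> y z"
  shows "pseudometric_on S \<rho>"
  using assms unfolding pseudometric_on_def by blast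

lemma pseudometric_on_nonneg:
  assumes "pseudometric_on S \<rho>" "x \<in> S" "y \<in> S"
  shows "0 \<le> \<rho> x y"
proof -
  have "\<rho> x x \<le> \<rho> x y + \<rho> y x" "\<rho> x x = 0" "\<rho> x y = \<rho> y x"
    using assms unfolding pseudometric_on_def by blast+
  then show ?thesis by linarith
qed

text \<open>Reduces triangle inequalities between infima to one inequality for each pair of
  indices.\<close>

lemma le_INF_add_INF:
  fixes f :: "'i \<Rightarrow> real" and g :: "'j \<Rightarrow> real"
  assumes "I \<noteq> {}" "J \<noteq> {}"
    and "\<And>i j. i \<in> I \<Longrightarrow> j \<in> J \<Longrightarrow> r \<le> f i + g j"
  shows "r \<le> (INF i\<in>I. f i) + (INF j\<in>J. g j)"
proof -
  have "r - (INF j\<in>J. g j) \<le> f i" if "i \<in> I" for i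
  proof -
    have "r - f i \<le> (INF j\<in>J. g j)"
      using assms(2) assms(3)[OF that] by (intro cINF_greatest) (auto simp: algebra_simps)
    then show ?thesis by simp
  qed
  then have "r - (INF j\<in>J. g j) \<le> (INF i\<in>I. f i)"
    using assms(1) by (intro cINF_greatest)
  then show ?thesis by simp
qed

text \<open>The shortest-path amalgam, with \<open>C\<close> the prescribed distance between an old
  and a new point. Under the hypotheses of \<open>glue_pseudometric\<close> longer paths gain
  nothing, so between new points only the direct distance \<open>E\<close> and a single detour
  through \<open>Y\<close> compete.\<close>

definition glue ::
  "'x set \<Rightarrow> ('x \<Rightarrow> 'x \<Rightarrow> real) \<Rightarrow> ('x \<Rightarrow> 'x \<Rightarrow> real) \<Rightarrow> ('x \<Rightarrow> 'x \<Rightarrow> real) \<Rightarrow> 'x \<Rightarrow> 'x \<Rightarrow> real" where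
  "glue Y \<rho> E C p q =
     (if p \<in> Y then (if q \<in> Y then \<rho> p q else C p q)
      else if q \<in> Y then C q p else min (E p q) (INF z\<in>Y. C z p + C z q))"

text \<open>\<open>C1\<close> and \<open>C2\<close> absorb an old or a new step at the end of a path
  into \<open>C\<close>; \<open>C3\<close> forbids shortcuts between old points through a new one.
  Of two successive detours, \<open>C3\<close> replaces the middle part, from \<open>w\<close>
  through \<open>q\<close> to \<open>w'\<close>, by an old step.\<close>

lemma glue_pseudometric:
  assumes Y: "Y \<noteq> {}" "Y \<inter> Z = {}"
    and \<rho>: "pseudometric_on Y \<rho>" and E: "pseudometric_on Z E"
    and C0: "\<And>z p. z \<in> Y \<Longrightarrow> p \<in> Z \<Longrightarrow> 0 \<le> C z p"
    and C1: "\<And>z z' p. z \<in> Y \<Longrightarrow> z' \<in> Y \<Longrightarrow> p \<in> Z \<Longrightarrow> C z p \<le> \<rho> z z' + C z' p"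
    and C2: "\<And>z p q. z \<in> Y \<Longrightarrow> p \<in> Z \<Longrightarrow> q \<in> Z \<Longrightarrow> C z p \<le> C z q + E q p"
    and C3: "\<And>z z' p. z \<in> Y \<Longrightarrow> z' \<in> Y \<Longrightarrow> p \<in> Z \<Longrightarrow> \<rho> z z' \<le> C z p + C z' p"
  shows "pseudometric_on (Y \<union> Z) (glue Y \<rho> E C)"
proof (rule pseudometric_onI)
  define F where "F p q = (INF z\<in>Y. C z p + C z q)" for p q
  have [simp]: "glue Y \<rho> E C p q = (if p \<in> Y then (if q \<in> Y then \<rho> p q else C p q)
      else if q \<in> Y then C q p else min (E p q) (F p q))" for p q
    by (simp add: glue_def F_def)
  have nY: "p \<notin> Y" if "p \<in> Z" for p using that Y by blast
  have \<rho>0: "\<rho> x x = 0" if "x \<in> Y" for x using \<rho> that unfolding pseudometric_on_def by blast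
  have \<rho>s: "\<rho> x y = \<rho> y x" if "x \<in> Y" "y \<in> Y" for x y
    using \<rho> that unfolding pseudometric_on_def by blast
  have \<rho>t: "\<rho> x z \<le> \<rho> x y + \<rho> y z" if "x \<in> Y" "y \<in> Y" "z \<in> Y" for x y z
    using \<rho> that unfolding pseudometric_on_def by blast
  have E0: "E x x = 0" if "x \<in> Z" for x using E that unfolding pseudometric_on_def by blast
  have Es: "E x y = E y x" if "x \<in> Z" "y \<in> Z" for x y
    using E that unfolding pseudometric_on_def by blast
  have Et: "E x z \<le> E x y + E y z" if "x \<in> Z" "y \<in> Z" "z \<in> Z" for x y z
    using E that unfolding pseudometric_on_def by blast
  have Fl: "F p q \<le> C z p + C z q" if "p \<in> Z" "q \<in> Z" "z \<in> Y" for p q z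
    using that C0 unfolding F_def by (intro cINF_lower bdd_belowI2[of _ 0]) auto
  have Fg: "r \<le> F p q" if "\<And>z. z \<in> Y \<Longrightarrow> r \<le> C z p + C z q" for r p q
    using that Y unfolding F_def by (intro cINF_greatest) auto
  have Fs: "F p q = F q p" for p q by (simp add: F_def add.commute)
  have C2': "C z p \<le> C z q + E p q" if "z \<in> Y" "p \<in> Z" "q \<in> Z" for z p q
    using C2[OF that] Es[OF that(2,3)] by simp
  have CF: "C z p \<le> C z q + F q p" if "z \<in> Y" "p \<in> Z" "q \<in> Z" for z p q
  proof -
    have "C z p - C z q \<le> F q p"
    proof (rule Fg)
      fix w assume w: "w \<in> Y"
      show "C z p - C z q \<le> C w q + C w p"
        using C1[OF that(1) w that(2)] C3[OF that(1) w that(3)] by linarith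
    qed
    then show ?thesis by linarith
  qed
  have FE: "F p r \<le> F p q + E q r" if "p \<in> Z" "q \<in> Z" "r \<in> Z" for p q r
  proof -
    have "F p r - E q r \<le> F p q"
    proof (rule Fg)
      fix w assume w: "w \<in> Y"
      show "F p r - E q r \<le> C w p + C w q"
        using Fl[OF that(1,3) w] C2[OF w that(3,2)] by linarith
    qed
    then show ?thesis by linarith
  qed
  have FF: "F p r \<le> F p q + F q r" if "p \<in> Z" "q \<in> Z" "r \<in> Z" for p q r
  unfolding F_def[of p q] F_def[of q r]
  proof (rule le_INF_add_INF[OF Y(1) Y(1)])
    fix w w' assume w: "w \<in> Y" "w' \<in> Y"
    show "F p r \<le> C w p + C w q + (C w' q + C w' r)"
      using Fl[OF that(1,3) w(1)] C1[OF w that(3)] C3[OF w that(2)] by linarith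
  qed
  show "glue Y \<rho> E C x x = 0" if "x \<in> Y \<union> Z" for x
  proof -
    have "0 \<le> F x x" if "x \<in> Z" by (rule Fg) (use C0 that in auto)
    then show ?thesis using that \<rho>0 E0 nY by auto
  qed
  show "glue Y \<rho> E C x y = glue Y \<rho> E C y x" if "x \<in> Y \<union> Z" "y \<in> Y \<union> Z" for x y
    using that \<rho>s Es Fs[of x y] nY by auto
  show "glue Y \<rho> E C x z \<le> glue Y \<rho> E C x y + glue Y \<rho> E C y z"
    if xyz: "x \<in> Y \<union> Z" "y \<in> Y \<union> Z" "z \<in> Y \<union> Z" for x y z
  proof -
    consider "x \<in> Y" "y \<in> Y" "z \<in> Y" | "x \<in> Y" "y \<in> Y" "z \<in> Z" | "x \<in> Y" "y \<in> Z" "z \<in> Y"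
      | "x \<in> Y" "y \<in> Z" "z \<in> Z" | "x \<in> Z" "y \<in> Y" "z \<in> Y" | "x \<in> Z" "y \<in> Y" "z \<in> Z"
      | "x \<in> Z" "y \<in> Z" "z \<in> Y" | "x \<in> Z" "y \<in> Z" "z \<in> Z"
      using xyz by blast
    then show ?thesis
    proof cases
      case 1 then show ?thesis using \<rho>t by simp
    next
      case 2 then show ?thesis using C1 nY by simp
    next
      case 3 then show ?thesis using C3 nY by simp
    next
      case 4 then show ?thesis using C2[of x z y] CF[of x z y] nY by (simp add: min_def)
    next
      case 5 then show ?thesis using C1[of z y x] \<rho>s nY by (simp add: add.commute)
    next
      case 6 then show ?thesis using Fl[of x z y] nY by (simp add: min_def)
    next
      case 7 then show ?thesis using C2'[of z x y] CF[of z x y] Fs[of x y] nY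
        by (simp add: min_def add.commute)
    next
      case 8
      have "min (E x z) (F x z) \<le> min (E x y) (F x y) + min (E y z) (F y z)"
        using Et[of x y z] FE[of x y z] FE[of z y x] FF[of x y z] 8 Es[of x y] Es[of y z]
          Fs[of x y] Fs[of y z] Fs[of x z]
        by (simp add: min_def)
      then show ?thesis using 8 nY by simp
    qed
  qed
qed

fun lact :: "('a, 'b) monoid_scheme \<Rightarrow> 'a \<Rightarrow> (nat \<times> 'a) list \<Rightarrow> (nat \<times> 'a) list" where
  "lact G g [] = []"
| "lact G g ((n, x) # w) = (n, g \<otimes>\<^bsub>G\<^esub> x) # w"

section \<open>Partial actions of the HNN extension\<close>

locale hnn_base = group G for G :: "('a, 'b) monoid_scheme" (structure) +
  fixes d :: "'a \<Rightarrow> 'a \<Rightarrow> real" and A B :: "'a set" and \<phi> :: "'a \<Rightarrow> 'a" and K :: real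
  assumes biinv: "biinv_metric G d"
    and subA: "subgroup A G" and subB: "subgroup B G"
    and bij: "bij_betw \<phi> A B"
    and \<phi>_mult: "\<And>a b. a \<in> A \<Longrightarrow> b \<in> A \<Longrightarrow> \<phi> (a \<otimes> b) = \<phi> a \<otimes> \<phi> b"
    and \<phi>_isom: "\<And>a b. a \<in> A \<Longrightarrow> b \<in> A \<Longrightarrow> d (\<phi> a) (\<phi> b) = d a b"
    and K_pos: "0 < K"
    and A_bound: "\<And>a. a \<in> A \<Longrightarrow> d a \<one> \<le> K"
begin

abbreviation act where "act \<equiv> lact G"

lemma A_carr: "a \<in> A \<Longrightarrow> a \<in> carrier G"
  using subA subgroup.mem_carrier by metis

lemma B_carr: "a \<in> B \<Longrightarrow> a \<in> carrier G"
  using subB subgroup.mem_carrier by metis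

lemma \<phi>_B: "a \<in> A \<Longrightarrow> \<phi> a \<in> B"
  using bij by (auto simp: bij_betw_def)

lemma \<phi>_carr: "a \<in> A \<Longrightarrow> \<phi> a \<in> carrier G"
  using \<phi>_B B_carr by blast

lemma oneA: "\<one> \<in> A" using subA subgroup.one_closed by blast
lemma multA: "a \<in> A \<Longrightarrow> b \<in> A \<Longrightarrow> a \<otimes> b \<in> A" using subA subgroup.m_closed by metis
lemma invA: "a \<in> A \<Longrightarrow> inv a \<in> A" using subA subgroup.m_inv_closed by metis

lemma \<phi>_one: "\<phi> \<one> = \<one>"
proof -
  have "\<phi> \<one> \<otimes> \<phi> \<one> = \<phi> \<one> \<otimes> \<one>" using \<phi>_mult[OF oneA oneA] \<phi>_carr[OF oneA] by simp
  then show ?thesis using \<phi>_carr[OF oneA] l_cancel by blast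
qed

lemma \<phi>_inv: assumes "a \<in> A" shows "\<phi> (inv a) = inv (\<phi> a)"
proof -
  have "\<phi> (inv a) \<otimes> \<phi> a = \<one>"
    using \<phi>_mult[OF invA[OF assms] assms] A_carr[OF assms] \<phi>_one by simp
  then show ?thesis using inv_equality \<phi>_carr invA assms by metis
qed

lemma MS: "Metric_space (carrier G) d"
  using biinv by (simp add: biinv_metric_def)

lemma d_left: "g \<in> carrier G \<Longrightarrow> x \<in> carrier G \<Longrightarrow> y \<in> carrier G \<Longrightarrow> d (g \<otimes> x) (g \<otimes> y) = d x y"
  and d_right: "g \<in> carrier G \<Longrightarrow> x \<in> carrier G \<Longrightarrow> y \<in> carrier G \<Longrightarrow> d (x \<otimes> g) (y \<otimes> g) = d x y"
  using biinv by (auto simp: biinv_metric_def)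

lemma d_sym: "d x y = d y x" and d_nonneg: "0 \<le> d x y"
  using MS by (auto simp: Metric_space_def)

lemma d_self: "x \<in> carrier G \<Longrightarrow> d x x = 0"
  using MS by (auto simp: Metric_space_def)

lemma d_triangle:
  "x \<in> carrier G \<Longrightarrow> y \<in> carrier G \<Longrightarrow> z \<in> carrier G \<Longrightarrow> d x z \<le> d x y + d y z"
  using MS by (auto simp: Metric_space_def)

lemma d_inv: assumes "x \<in> carrier G" "y \<in> carrier G" shows "d (inv x) (inv y) = d x y"
proof -
  have "d (inv x) (inv y) = d (x \<otimes> inv x \<otimes> y) (x \<otimes> inv y \<otimes> y)"
    using assms d_left[of x "inv x" "inv y"] d_right[of y "x \<otimes> inv x" "x \<otimes> inv y"] by simp
  also have "\<dots> = d y x" using assms by (simp add: m_assoc)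
  finally show ?thesis by (simp add: d_sym)
qed

text \<open>Exchanges \<open>t\<close> with \<open>t^-1\<close>, so that one construction serves
  both directions. The bound on \<open>B\<close> follows from that on \<open>A\<close> because
  \<open>\<phi>\<close> is an isometry fixing the identity.\<close>

lemma hnn_base_swap:
  assumes "\<And>b. b \<in> B \<Longrightarrow> \<psi> b \<in> A \<and> \<phi> (\<psi> b) = b"
  shows "hnn_base G d B A \<psi> K"
proof -
  have \<psi>': "\<psi> (\<phi> a) = a" if "a \<in> A" for a
    using bij that assms \<phi>_B by (metis bij_betw_def inj_onD)
  show ?thesis
  proof (intro hnn_base.intro hnn_base_axioms.intro group_axioms)
    show "bij_betw \<psi> B A"
      using assms \<psi>' \<phi>_B by (intro bij_betw_byWitness[where f' = \<phi>]) auto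
    show "\<psi> (a \<otimes> b) = \<psi> a \<otimes> \<psi> b" if "a \<in> B" "b \<in> B" for a b
      using \<psi>' \<phi>_mult assms multA that by metis
    show "d (\<psi> a) (\<psi> b) = d a b" if "a \<in> B" "b \<in> B" for a b
      using \<phi>_isom assms that by metis
    show "d a \<one> \<le> K" if "a \<in> B" for a
      using \<phi>_isom[of "\<psi> a" \<one>] assms[OF that] oneA A_bound \<phi>_one by force
  qed (use biinv subA subB K_pos in auto)
qed

end

text \<open>A point is a list of letters with strictly decreasing tags: \<open>(n, g) # y\<close> stands for \<open>g t y\<close> or
  \<open>g t\<^sup>-\<^sup>1 y\<close>, according to the parity of the step \<open>n\<close> at which it was adjoined. The relation \<open>R\<close> is the
  graph of \<open>t\<close>, single-valued only up to distance zero.\<close>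

locale stage = hnn_base G d A B \<phi> K
  for G :: "('a, 'b) monoid_scheme" (structure) and d A B \<phi> K +
  fixes S :: "(nat \<times> 'a) list set" and \<rho> :: "(nat \<times> 'a) list \<Rightarrow> (nat \<times> 'a) list \<Rightarrow> real"
    and R :: "((nat \<times> 'a) list \<times> (nat \<times> 'a) list) set"
  assumes S_ne: "S \<noteq> {}"
    and pm: "pseudometric_on S \<rho>"
    and S_form: "\<And>x. x \<in> S \<Longrightarrow> \<exists>n g w. x = (n, g) # w \<and> g \<in> carrier G"
    and act_closed: "\<And>g x. g \<in> carrier G \<Longrightarrow> x \<in> S \<Longrightarrow> act g x \<in> S"
    and \<rho>_act: "\<And>g x y. g \<in> carrier G \<Longrightarrow> x \<in> S \<Longrightarrow> y \<in> S \<Longrightarrow> \<rho> (act g x) (act g y) = \<rho> x y"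
    and \<rho>_disp: "\<And>g x. g \<in> carrier G \<Longrightarrow> x \<in> S \<Longrightarrow> \<rho> (act g x) x \<le> d g \<one>"
    and R_sub: "R \<subseteq> S \<times> S"
    and R_K: "\<And>x y. (x, y) \<in> R \<Longrightarrow> \<rho> x y \<le> K"
    and R_isom: "\<And>x y x' y'. (x, y) \<in> R \<Longrightarrow> (x', y') \<in> R \<Longrightarrow> \<rho> x x' = \<rho> y y'"
    and R_act: "\<And>x y a. (x, y) \<in> R \<Longrightarrow> a \<in> A \<Longrightarrow> (act a x, act (\<phi> a) y) \<in> R"
begin

lemma act_one: "x \<in> S \<Longrightarrow> act \<one> x = x"
  using S_form[of x] by auto

lemma act_mult: "g \<in> carrier G \<Longrightarrow> h \<in> carrier G \<Longrightarrow> x \<in> S \<Longrightarrow> act (g \<otimes> h) x = act g (act h x)"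
  using S_form[of x] by (auto simp: m_assoc)

lemma act_inv: "g \<in> carrier G \<Longrightarrow> x \<in> S \<Longrightarrow> act (inv g) (act g x) = x"
  "g \<in> carrier G \<Longrightarrow> x \<in> S \<Longrightarrow> act g (act (inv g) x) = x"
  using act_mult[of g "inv g" x] act_mult[of "inv g" g x] act_one[of x] by auto

lemma \<rho>_self: "x \<in> S \<Longrightarrow> \<rho> x x = 0"
  and \<rho>_sym: "x \<in> S \<Longrightarrow> y \<in> S \<Longrightarrow> \<rho> x y = \<rho> y x"
  and \<rho>_tri: "x \<in> S \<Longrightarrow> y \<in> S \<Longrightarrow> z \<in> S \<Longrightarrow> \<rho> x z \<le> \<rho> x y + \<rho> y z"
  using pm unfolding pseudometric_on_def by blast+

lemma \<rho>_nonneg: "x \<in> S \<Longrightarrow> y \<in> S \<Longrightarrow> 0 \<le> \<rho> x y"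
  using pm pseudometric_on_nonneg by metis

lemma R_S: "(x, y) \<in> R \<Longrightarrow> x \<in> S" "(x, y) \<in> R \<Longrightarrow> y \<in> S"
  using R_sub by auto

lemma \<rho>_act2: 
  assumes "g \<in> carrier G" "h \<in> carrier G" "x \<in> S"
  shows "\<rho> (act g x) (act h x) \<le> d g h"
proof -
  have "\<rho> (act g x) (act h x) = \<rho> (act (inv h) (act g x)) (act (inv h) (act h x))"
    using assms \<rho>_act act_closed by simp
  also have "\<dots> = \<rho> (act (inv h \<otimes> g) x) x" using assms act_inv act_mult by simp
  also have "\<dots> \<le> d (inv h \<otimes> g) \<one>" using assms \<rho>_disp by simp
  also have "\<dots> = d (inv h \<otimes> g) (inv h \<otimes> h)" using assms by simp
  also have "\<dots> = d g h" using assms d_left[of "inv h" g h] by simp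
  finally show ?thesis .
qed

lemma \<rho>_shift:
  assumes "g \<in> carrier G" "x \<in> S" "y \<in> S"
  shows "\<rho> (act (inv g) x) y = \<rho> x (act g y)"
  using \<rho>_act[of g "act (inv g) x" y] assms act_inv act_closed by simp

text \<open>The converse of the graph of \<open>t\<close> is the graph of \<open>t^-1\<close>, and
  equivariance becomes \<open>t^-1 b = \<psi> b t^-1\<close>.\<close>

lemma stage_swap:
  assumes \<psi>: "\<And>b. b \<in> B \<Longrightarrow> \<psi> b \<in> A \<and> \<phi> (\<psi> b) = b"
  shows "stage G d B A \<psi> K S \<rho> (R\<inverse>)"
proof (intro stage.intro stage_axioms.intro hnn_base_swap)
  show "\<rho> x y \<le> K" if "(x, y) \<in> R\<inverse>" for x y
    using that R_K[of y x] R_S[of y x] \<rho>_sym by simp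
  show "\<rho> x x' = \<rho> y y'" if "(x, y) \<in> R\<inverse>" "(x', y') \<in> R\<inverse>" for x y x' y'
    using that R_isom by simp
  show "(act a x, act (\<psi> a) y) \<in> R\<inverse>" if "(x, y) \<in> R\<inverse>" "a \<in> B" for x y a
    using R_act[of y x "\<psi> a"] that \<psi> by simp
qed (use \<psi> S_ne pm S_form act_closed \<rho>_act \<rho>_disp R_sub in auto)

text \<open>A jump \<open>(y0, y1, c)\<close> records that \<open>y1\<close> must lie within \<open>c\<close> of \<open>t y0\<close>; \<open>D z y\<close> is the prospective
  distance from \<open>z\<close> to \<open>t y\<close>.\<close>

definition jumps where
  "jumps = {(act a x, act (\<phi> a) x, K) | a x. a \<in> A \<and> x \<in> S} \<union> {(x, y, 0) | x y. (x, y) \<in> R}"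

definition D where "D z y = (INF (y0, y1, c)\<in>jumps. \<rho> z y1 + c + \<rho> y0 y)"

lemma jump_in: "a \<in> A \<Longrightarrow> x \<in> S \<Longrightarrow> (act a x, act (\<phi> a) x, K) \<in> jumps"
  "(x, y) \<in> R \<Longrightarrow> (x, y, 0) \<in> jumps"
  by (auto simp: jumps_def)

lemma jumpE:
  assumes "(y0, y1, c) \<in> jumps"
  obtains a x where "a \<in> A" "x \<in> S" "y0 = act a x" "y1 = act (\<phi> a) x" "c = K"
  | "(y0, y1) \<in> R" "c = 0"
  using assms by (auto simp: jumps_def)

lemma jump_S: "(y0, y1, c) \<in> jumps \<Longrightarrow> y0 \<in> S \<and> y1 \<in> S \<and> 0 \<le> c"
  using A_carr \<phi>_carr act_closed R_S K_pos by (auto elim!: jumpE)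

text \<open>The \<open>K\<close>-jumps carry a parameter from \<open>A\<close> for the sake of this
  closure: \<open>t (a x) = \<phi> a (t x)\<close> lies within \<open>K\<close> of
  \<open>\<phi> a x\<close>, since \<open>t x\<close> is to lie within \<open>K\<close> of
  \<open>x\<close>.\<close>

lemma jump_act: 
  assumes "(y0, y1, c) \<in> jumps" "a \<in> A"
  shows "(act a y0, act (\<phi> a) y1, c) \<in> jumps"
  using assms(1)
proof (cases rule: jumpE)
  case (1 b x)
  then show ?thesis using jump_in(1)[of "a \<otimes> b" x] assms(2) multA A_carr \<phi>_carr
    by (simp add: act_mult \<phi>_mult)
next
  case 2
  then show ?thesis using jump_in(2) R_act assms by simp
qed

lemma \<rho>_close:
  assumes "x \<in> S" "x' \<in> S" "y \<in> S" "y' \<in> S"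
  shows "\<bar>\<rho> x y - \<rho> x' y'\<bar> \<le> \<rho> x x' + \<rho> y y'"
proof -
  have "\<rho> x y \<le> \<rho> x x' + \<rho> x' y" "\<rho> x' y \<le> \<rho> x' y' + \<rho> y' y"
    "\<rho> x' y' \<le> \<rho> x' x + \<rho> x y'" "\<rho> x y' \<le> \<rho> x y + \<rho> y y'"
    using assms \<rho>_tri by blast+
  moreover have "\<rho> x x' = \<rho> x' x" "\<rho> y y' = \<rho> y' y" using assms \<rho>_sym by blast+
  ultimately show ?thesis by linarith
qed

text \<open>Both elements lie within \<open>K\<close> of the identity, which \<phi> fixes. This
  bound pays for the pairs of \<open>K\<close>-jumps in \<open>jump_dist\<close>.\<close>

lemma d_\<phi>: assumes "a \<in> A" shows "d a (\<phi> a) \<le> 2 * K"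
proof -
  have "d a (\<phi> a) \<le> d a \<one> + d \<one> (\<phi> a)" using d_triangle assms A_carr \<phi>_carr by simp
  moreover have "d \<one> (\<phi> a) = d \<one> a" using \<phi>_isom[OF oneA assms] \<phi>_one by simp
  ultimately show ?thesis using A_bound[OF assms] d_sym[of a \<one>] by simp
qed

text \<open>Translating by \<open>inv a\<close> and \<open>inv (\<phi> a)\<close> reduces to
  comparing the two members of a pair in \<open>R\<close> with the same point \<open>u\<close>; they
  are at most \<open>K\<close> apart.\<close>

lemma jump_dist_mixed:
  assumes "(x, y) \<in> R" "a \<in> A" "u \<in> S"
  shows "\<bar>\<rho> x (act a u) - \<rho> y (act (\<phi> a) u)\<bar> \<le> K"
proof -
  let ?x = "act (inv a) x" and ?y = "act (inv (\<phi> a)) y"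
  have R: "(?x, ?y) \<in> R" using R_act[OF assms(1) invA[OF assms(2)]] \<phi>_inv assms by simp
  have "\<rho> ?x u = \<rho> x (act a u)" "\<rho> ?y u = \<rho> y (act (\<phi> a) u)"
    using \<rho>_shift assms A_carr \<phi>_carr R_S by auto
  moreover have "\<bar>\<rho> ?x u - \<rho> ?y u\<bar> \<le> \<rho> ?x ?y + \<rho> u u"
    using \<rho>_close R R_S assms by blast
  ultimately show ?thesis using R_K[OF R] \<rho>_self assms by simp
qed

text \<open>The consistency condition of the construction: \<open>t\<close> is to be isometric,
  while \<open>y\<close> and \<open>y'\<close> are to lie within \<open>c\<close> and
  \<open>c'\<close> of \<open>t x\<close> and \<open>t x'\<close>. It is what protects the old
  distances in \<open>D_kat1\<close> and \<open>D_kat2\<close>.\<close>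

lemma jump_dist:
  assumes "(x, y, c) \<in> jumps" "(x', y', c') \<in> jumps"
  shows "\<bar>\<rho> x x' - \<rho> y y'\<bar> \<le> c + c'"
  using assms(1)
proof (cases rule: jumpE)
  case 1: (1 a u)
  from assms(2) show ?thesis
  proof (cases rule: jumpE)
    case 2: (1 b v)
    \<comment> \<open>Cancelling \<open>b\<close> leaves \<open>v\<close> to be compared with
      \<open>act ?e u\<close> and with \<open>act (\<phi> ?e) u\<close>, which are at most
      \<open>2 * K\<close> apart.\<close>
    let ?e = "inv b \<otimes> a"
    have e: "?e \<in> A" using 1 2 multA invA by simp
    have "\<rho> x x' = \<rho> (act (inv b) (act a u)) v"
      using \<rho>_shift[of b "act a u" v] 1 2 A_carr act_closed by simp
    then have x: "\<rho> x x' = \<rho> (act ?e u) v" using 1 2 A_carr act_mult by simp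
    have "\<rho> y y' = \<rho> (act (inv (\<phi> b)) (act (\<phi> a) u)) v"
      using \<rho>_shift[of "\<phi> b" "act (\<phi> a) u" v] 1 2 \<phi>_carr act_closed by simp
    then have y: "\<rho> y y' = \<rho> (act (\<phi> ?e) u) v"
      using 1 2 \<phi>_carr act_mult[of "inv (\<phi> b)" "\<phi> a" u] \<phi>_mult invA \<phi>_inv by simp
    have "\<bar>\<rho> x x' - \<rho> y y'\<bar> \<le> \<rho> (act ?e u) (act (\<phi> ?e) u) + \<rho> v v"
      unfolding x y using 1 2 e A_carr \<phi>_carr act_closed by (intro \<rho>_close) auto
    also have "\<dots> \<le> 2 * K"
      using \<rho>_act2[of ?e "\<phi> ?e" u] d_\<phi>[OF e] 1 2 e A_carr \<phi>_carr \<rho>_self[of v] by fastforce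
    finally show ?thesis using 1 2 by simp
  next
    case 2
    have "\<bar>\<rho> x' x - \<rho> y' y\<bar> \<le> K" using jump_dist_mixed[OF 2(1) 1(1,2)] 1 by simp
    then show ?thesis using 1 2 \<rho>_sym jump_S assms by (metis add.right_neutral)
  qed
next
  case 1: 2
  from assms(2) show ?thesis
  proof (cases rule: jumpE)
    case 2: (1 b v)
    then show ?thesis using jump_dist_mixed[OF 1(1) 2(1,2)] 1 by simp
  next
    case 2
    then show ?thesis using R_isom 1 by fastforce
  qed
qed

section \<open>The prospective distance to points \<open>t y\<close>\<close>

lemma jumps_ne: "jumps \<noteq> {}"
  using jump_in(1)[OF oneA] S_ne by blast

lemma D_le:
  assumes "(y0, y1, c) \<in> jumps" "z \<in> S" "y \<in> S"
  shows "D z y \<le> \<rho> z y1 + c + \<rho> y0 y"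
proof -
  have "bdd_below ((\<lambda>(y0, y1, c). \<rho> z y1 + c + \<rho> y0 y) ` jumps)"
  proof (rule bdd_belowI2[of _ 0], clarify)
    fix u0 u1 e assume "(u0, u1, e) \<in> jumps"
    then show "0 \<le> \<rho> z u1 + e + \<rho> u0 y"
      using \<rho>_nonneg assms jump_S[of u0 u1 e] by (simp add: add_nonneg_nonneg)
  qed
  from cINF_lower[OF this assms(1)] show ?thesis unfolding D_def by simp
qed

lemma D_ge:
  assumes "\<And>y0 y1 c. (y0, y1, c) \<in> jumps \<Longrightarrow> r \<le> \<rho> z y1 + c + \<rho> y0 y"
  shows "r \<le> D z y"
  unfolding D_def by (rule cINF_greatest[OF jumps_ne]) (use assms in auto)

lemma D_ge2:
  assumes "\<And>y0 y1 c y0' y1' c'. (y0, y1, c) \<in> jumps \<Longrightarrow> (y0', y1', c') \<in> jumps \<Longrightarrow>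
    r \<le> (\<rho> z y1 + c + \<rho> y0 y) + (\<rho> z' y1' + c' + \<rho> y0' y')"
  shows "r \<le> D z y + D z' y'"
  unfolding D_def by (rule le_INF_add_INF[OF jumps_ne jumps_ne]) (use assms in auto)

lemma D_nonneg: "z \<in> S \<Longrightarrow> y \<in> S \<Longrightarrow> 0 \<le> D z y"
  by (rule D_ge) (use \<rho>_nonneg jump_S in \<open>simp add: add_nonneg_nonneg\<close>)

lemma D_lip1:
  assumes "z \<in> S" "z' \<in> S" "y \<in> S"
  shows "D z y \<le> \<rho> z z' + D z' y"
proof -
  have "D z y - \<rho> z z' \<le> D z' y"
  proof (rule D_ge)
    fix y0 y1 c assume j: "(y0, y1, c) \<in> jumps"
    show "D z y - \<rho> z z' \<le> \<rho> z' y1 + c + \<rho> y0 y"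
      using D_le[OF j assms(1,3)] \<rho>_tri[OF assms(1,2), of y1] jump_S[OF j] by linarith
  qed
  then show ?thesis by linarith
qed

lemma D_lip2:
  assumes "z \<in> S" "y \<in> S" "y' \<in> S"
  shows "D z y \<le> D z y' + \<rho> y' y"
proof -
  have "D z y - \<rho> y' y \<le> D z y'"
  proof (rule D_ge)
    fix y0 y1 c assume j: "(y0, y1, c) \<in> jumps"
    show "D z y - \<rho> y' y \<le> \<rho> z y1 + c + \<rho> y0 y'"
      using D_le[OF j assms(1,2)] \<rho>_tri[of y0 y' y] assms jump_S[OF j] by linarith
  qed
  then show ?thesis by linarith
qed

text \<open>A trip from \<open>z\<close> to \<open>z'\<close> through \<open>t y\<close> uses two
  jumps. By \<open>jump_dist\<close> their cost \<open>c + c'\<close> covers the defect between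
  \<rho> y1 y1' and \<rho> y0 y0', so no old distance is shortened.\<close>

lemma D_kat1:
  assumes "z \<in> S" "z' \<in> S" "y \<in> S"
  shows "\<rho> z z' \<le> D z y + D z' y"
proof (rule D_ge2)
  fix y0 y1 c y0' y1' c'
  assume j: "(y0, y1, c) \<in> jumps" "(y0', y1', c') \<in> jumps"
  note s = jump_S[OF j(1)] jump_S[OF j(2)]
  have "\<rho> z z' \<le> \<rho> z y1 + \<rho> y1 z'" "\<rho> y1 z' \<le> \<rho> y1 y1' + \<rho> y1' z'" "\<rho> y1' z' = \<rho> z' y1'"
    "\<rho> y0 y0' \<le> \<rho> y0 y + \<rho> y y0'" "\<rho> y y0' = \<rho> y0' y"
    using assms s \<rho>_tri \<rho>_sym by blast+
  then show "\<rho> z z' \<le> (\<rho> z y1 + c + \<rho> y0 y) + (\<rho> z' y1' + c' + \<rho> y0' y)"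
    using jump_dist[OF j] by linarith
qed

text \<open>The mirror image of \<open>D_kat1\<close>: a trip from \<open>t y\<close> to
  \<open>t y'\<close> through an old point must not undercut \<rho> y y' if \<open>t\<close> is to
  be isometric.\<close>

lemma D_kat2:
  assumes "z \<in> S" "y \<in> S" "y' \<in> S"
  shows "\<rho> y y' \<le> D z y + D z y'"
proof (rule D_ge2)
  fix y0 y1 c y0' y1' c'
  assume j: "(y0, y1, c) \<in> jumps" "(y0', y1', c') \<in> jumps"
  note s = jump_S[OF j(1)] jump_S[OF j(2)]
  have "\<rho> y y' \<le> \<rho> y y0 + \<rho> y0 y'" "\<rho> y0 y' \<le> \<rho> y0 y0' + \<rho> y0' y'" "\<rho> y y0 = \<rho> y0 y"
    "\<rho> y1 y1' \<le> \<rho> y1 z + \<rho> z y1'" "\<rho> y1 z = \<rho> z y1"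
    using assms s \<rho>_tri \<rho>_sym by blast+
  then show "\<rho> y y' \<le> (\<rho> z y1 + c + \<rho> y0 y) + (\<rho> z y1' + c' + \<rho> y0' y')"
    using jump_dist[OF j] by linarith
qed

lemma D_act_le:
  assumes "z \<in> S" "y \<in> S" "a \<in> A"
  shows "D (act (\<phi> a) z) (act a y) \<le> D z y"
proof (rule D_ge)
  fix y0 y1 c assume j: "(y0, y1, c) \<in> jumps"
  show "D (act (\<phi> a) z) (act a y) \<le> \<rho> z y1 + c + \<rho> y0 y"
    using D_le[OF jump_act[OF j assms(3)], of "act (\<phi> a) z" "act a y"]
      \<rho>_act[of a y0 y] \<rho>_act[of "\<phi> a" z y1] jump_S[OF j] assms A_carr \<phi>_carr act_closed
    by simp
qed

text \<open>\<open>D_act_le\<close> for \<open>a\<close> and for \<open>inv a\<close>. It makes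
  distances independent of how a new point is named, since \<open>g \<phi>(a) t y\<close> and
  \<open>g t (a y)\<close> are to coincide.\<close>

lemma D_act:
  assumes "z \<in> S" "y \<in> S" "a \<in> A"
  shows "D (act (\<phi> a) z) (act a y) = D z y"
  using D_act_le[OF assms] D_act_le[of "act (\<phi> a) z" "act a y" "inv a"] assms
    A_carr \<phi>_carr act_closed invA \<phi>_inv act_inv
  by fastforce

lemma D_act':
  assumes "z \<in> S" "y \<in> S" "a \<in> A"
  shows "D (act (inv (\<phi> a)) z) y = D z (act a y)"
  using D_act[of "act (inv (\<phi> a)) z" y a] assms \<phi>_carr act_closed act_inv by simp

lemma D_diag: assumes "y \<in> S" shows "D y y \<le> K"
  using D_le[OF jump_in(1)[OF oneA assms] assms assms] assms \<rho>_self act_one \<phi>_one by simp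

text \<open>Where \<open>t y0\<close> is already realised as \<open>y1\<close>, the jump to
  \<open>y1\<close> is free, which gives the upper bound; \<open>D_kat2\<close> excludes anything
  smaller.\<close>

lemma D_R: assumes "(y0, y1) \<in> R" "y \<in> S" shows "D y1 y = \<rho> y0 y"
proof -
  note s = R_S[OF assms(1)]
  have "D y1 y \<le> \<rho> y0 y" "D y1 y0 \<le> 0"
    using D_le[OF jump_in(2)[OF assms(1)], of y1] s assms \<rho>_self by force+
  then show ?thesis using D_kat2[of y1 y0 y] s assms by linarith
qed

text \<open>A \<open>K\<close>-jump alone costs \<open>K\<close>, so only jumps along
  \<open>R\<close> have to be checked. This is the reason for claiming separation only for
  \<epsilon> at most \<open>K\<close>.\<close>

lemma D_far:
  assumes "z \<in> S" "y \<in> S" "\<epsilon> \<le> K"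
    and "\<And>y0 y1. (y0, y1) \<in> R \<Longrightarrow> \<epsilon> \<le> \<rho> z y1 + \<rho> y0 y"
  shows "\<epsilon> \<le> D z y"
proof (rule D_ge)
  fix y0 y1 c assume j: "(y0, y1, c) \<in> jumps"
  then show "\<epsilon> \<le> \<rho> z y1 + c + \<rho> y0 y"
  proof (cases rule: jumpE)
    case (1 a x)
    then show ?thesis using \<rho>_nonneg assms jump_S[OF j] by (smt (verit))
  next
    case 2
    then show ?thesis using assms by simp
  qed
qed

end

section \<open>One extension step\<close>

text \<open>The last two clauses are what later shows that reduced words move the base point.\<close>

definition step_rel where
  "step_rel G d B K S \<rho> R S' \<rho>' R' \<longleftrightarrow>
     S \<subseteq> S' \<and> (\<forall>x\<in>S. \<forall>y\<in>S. \<rho>' x y = \<rho> x y) \<and> R \<subseteq> R' \<and> Domain R' = S \<and>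
     (\<forall>\<epsilon> y y' g. 0 < \<epsilon> \<longrightarrow> \<epsilon> \<le> K \<longrightarrow> (y, y') \<in> R' \<longrightarrow> g \<in> carrier G \<longrightarrow>
        (\<forall>z\<in>Domain R. \<epsilon> \<le> \<rho> y z) \<longrightarrow>
        (\<forall>z\<in>S. \<epsilon> \<le> \<rho>' (lact G g y') z) \<and>
        ((\<forall>b\<in>B. \<epsilon> \<le> d g b) \<longrightarrow> (\<forall>z\<in>Range R'. \<epsilon> \<le> \<rho>' (lact G g y') z))) \<and>
     (\<forall>\<epsilon> y. \<epsilon> \<le> K \<longrightarrow> y \<in> S \<longrightarrow> (\<forall>z\<in>Range R. \<epsilon> \<le> \<rho> y z) \<longrightarrow> (\<forall>z\<in>Range R'. \<epsilon> \<le> \<rho>' y z))"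

locale fresh_stage = stage +
  fixes m :: nat
  assumes fresh: "\<And>x. x \<in> S \<Longrightarrow> fst (hd x) < m"
begin

text \<open>A point is adjoined for every \<open>y\<close> in \<open>S\<close>, even if
  \<open>R\<close> already offers a value of \<open>t\<close> at \<open>y\<close>; by
  \<open>D_R\<close> the new point with \<open>g = \<one>\<close> is then at distance zero from that
  value.\<close>

definition Z where "Z = {(m, g) # y | g y. g \<in> carrier G \<and> y \<in> S}"

text \<open>Since \<open>(g \<phi>(c), y)\<close> and \<open>(g, c y)\<close> name the same point for \<open>c\<close> in \<open>A\<close>, \<open>E\<close> is a quotient
  pseudometric.\<close>

definition E where
  "E p q = (INF c\<in>A. d (snd (hd p)) (snd (hd q) \<otimes> \<phi> c) + \<rho> (act c (tl p)) (tl q))"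

text \<open>Forced by invariance under \<open>G\<close>: the distance from \<open>z\<close> to
  \<open>g t y\<close> is that from \<open>g^-1 z\<close> to \<open>t y\<close>, which
  \<open>D\<close> prescribes.\<close>

definition C where "C z p = D (act (inv (snd (hd p))) z) (tl p)"

definition \<rho>' where "\<rho>' = glue S \<rho> E C"

text \<open>The new pairs express \<open>t (a y) = \<phi> a (t y)\<close>: \<open>a = \<one>\<close>
  makes \<open>t\<close> defined on all of \<open>S\<close>, the other values of \<open>a\<close>
  keep the relation equivariant under \<open>A\<close>.\<close>

definition R' where "R' = R \<union> {(act a y, (m, \<phi> a) # y) | a y. a \<in> A \<and> y \<in> S}"

lemma Z_E:
  assumes "p \<in> Z" obtains g y where "p = (m, g) # y" "g \<in> carrier G" "y \<in> S"
  using assms by (auto simp: Z_def)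

lemma Z_disj: "(m, g) # y \<notin> S"
  using fresh by fastforce

lemma S_Z: "S \<inter> Z = {}"
  using Z_disj by (auto simp: Z_def)

lemma C_eq: "C z ((m, g) # y) = D (act (inv g) z) y"
  by (simp add: C_def)

section \<open>The quotient pseudometric on the new points\<close>

lemma E_le:
  assumes "g \<in> carrier G" "y \<in> S" "h \<in> carrier G" "x \<in> S" "c \<in> A"
  shows "E ((m, g) # y) ((m, h) # x) \<le> d g (h \<otimes> \<phi> c) + \<rho> (act c y) x"
proof -
  have "bdd_below ((\<lambda>c. d g (h \<otimes> \<phi> c) + \<rho> (act c y) x) ` A)"
    using assms d_nonneg \<rho>_nonneg act_closed A_carr
    by (intro bdd_belowI2[of _ 0]) (simp add: add_nonneg_nonneg)
  from cINF_lower[OF this assms(5)] show ?thesis by (simp add: E_def)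
qed

lemma E_ge:
  assumes "\<And>c. c \<in> A \<Longrightarrow> r \<le> d g (h \<otimes> \<phi> c) + \<rho> (act c y) x"
  shows "r \<le> E ((m, g) # y) ((m, h) # x)"
  unfolding E_def using oneA assms by (intro cINF_greatest) auto

text \<open>Substituting \<open>inv c\<close> for \<open>c\<close> exchanges the two
  arguments.\<close>

lemma E_sym_le:
  assumes "p \<in> Z" "q \<in> Z"
  shows "E q p \<le> E p q"
proof -
  obtain g y h x where p: "p = (m, g) # y" "g \<in> carrier G" "y \<in> S"
    and q: "q = (m, h) # x" "h \<in> carrier G" "x \<in> S" using assms by (elim Z_E)
  show ?thesis unfolding p(1) q(1)
  proof (rule E_ge)
    fix c assume c: "c \<in> A"
    note cc = A_carr[OF c] \<phi>_carr[OF c]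
    have "d g (h \<otimes> \<phi> c) = d (g \<otimes> inv (\<phi> c)) (h \<otimes> \<phi> c \<otimes> inv (\<phi> c))"
      using d_right[of "inv (\<phi> c)" g "h \<otimes> \<phi> c"] cc p q by simp
    also have "\<dots> = d h (g \<otimes> \<phi> (inv c))" using cc p q c \<phi>_inv d_sym by (simp add: m_assoc)
    finally have 1: "d g (h \<otimes> \<phi> c) = d h (g \<otimes> \<phi> (inv c))" .
    have "\<rho> (act (inv c) x) y = \<rho> x (act c y)" using \<rho>_shift cc p q by simp
    then have 2: "\<rho> (act (inv c) x) y = \<rho> (act c y) x"
      using \<rho>_sym act_closed cc p q by simp
    show "E ((m, h) # x) ((m, g) # y) \<le> d g (h \<otimes> \<phi> c) + \<rho> (act c y) x"
      using E_le[of h x g y "inv c"] 1 2 p q c invA by simp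
  qed
qed

lemma E_pm: "pseudometric_on Z E"
proof (rule pseudometric_onI)
  fix p assume "p \<in> Z"
  then obtain g y where p: "p = (m, g) # y" "g \<in> carrier G" "y \<in> S" by (elim Z_E)
  have "E p p \<le> 0"
    using E_le[OF p(2,3,2,3) oneA] p \<phi>_one d_self act_one \<rho>_self by simp
  moreover have "0 \<le> E p p" unfolding p(1)
    by (rule E_ge) (use p d_nonneg \<rho>_nonneg act_closed A_carr in \<open>simp add: add_nonneg_nonneg\<close>)
  ultimately show "E p p = 0" by simp
next
  fix p q assume "p \<in> Z" "q \<in> Z"
  then show "E p q = E q p" using E_sym_le by (meson order_antisym)
next
  fix p q r assume "p \<in> Z" "q \<in> Z" "r \<in> Z"
  then obtain g y h x k w where p: "p = (m, g) # y" "g \<in> carrier G" "y \<in> S"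
    and q: "q = (m, h) # x" "h \<in> carrier G" "x \<in> S"
    and r: "r = (m, k) # w" "k \<in> carrier G" "w \<in> S" by (elim Z_E)
  show "E p r \<le> E p q + E q r"
    unfolding p(1) q(1) r(1) E_def[of "(m, g) # y" "(m, h) # x"] E_def[of "(m, h) # x" "(m, k) # w"]
  proof (rule le_INF_add_INF)
    fix c c' assume c: "c \<in> A" "c' \<in> A"
    note cc = A_carr[OF c(1)] \<phi>_carr[OF c(1)] A_carr[OF c(2)] \<phi>_carr[OF c(2)]
    \<comment> \<open>Renamings compose: \<open>c\<close> serves the pair \<open>p\<close>,
      \<open>q\<close> and \<open>c'\<close> the pair \<open>q\<close>, \<open>r\<close>, so
      \<open>c' \<otimes> c\<close> is the witness for \<open>p\<close>, \<open>r\<close>.\<close>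
    have "d (h \<otimes> \<phi> c) (k \<otimes> \<phi> (c' \<otimes> c)) = d (h \<otimes> \<phi> c) (k \<otimes> \<phi> c' \<otimes> \<phi> c)"
      using c cc r \<phi>_mult by (simp add: m_assoc)
    also have "\<dots> = d h (k \<otimes> \<phi> c')" using cc q r d_right by simp
    finally have "d g (k \<otimes> \<phi> (c' \<otimes> c)) \<le> d g (h \<otimes> \<phi> c) + d h (k \<otimes> \<phi> c')"
      using d_triangle[of g "h \<otimes> \<phi> c" "k \<otimes> \<phi> (c' \<otimes> c)"] c cc p q r \<phi>_carr multA by simp
    moreover have "\<rho> (act (c' \<otimes> c) y) w \<le> \<rho> (act c' (act c y)) (act c' x) + \<rho> (act c' x) w"
      using \<rho>_tri[of "act c' (act c y)" "act c' x" w] act_mult act_closed cc p q r by simp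
    moreover have "\<rho> (act c' (act c y)) (act c' x) = \<rho> (act c y) x"
      using \<rho>_act act_closed cc p q by simp
    ultimately show "E ((m, g) # y) ((m, k) # w) \<le>
      d (snd (hd ((m, g) # y))) (snd (hd ((m, h) # x)) \<otimes> \<phi> c) +
        \<rho> (act c (tl ((m, g) # y))) (tl ((m, h) # x)) +
      (d (snd (hd ((m, h) # x))) (snd (hd ((m, k) # w)) \<otimes> \<phi> c') +
        \<rho> (act c' (tl ((m, h) # x))) (tl ((m, k) # w)))"
      using E_le[OF p(2,3) r(2,3) multA[OF c(2,1)]] by simp
  qed (use oneA in auto)
qed

section \<open>The enlarged pseudometric\<close>

lemma C_shift:
  assumes "g \<in> carrier G" "h \<in> carrier G" "z \<in> S" "y \<in> S"
  shows "C (act h z) ((m, h \<otimes> g) # y) = C z ((m, g) # y)"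
  using assms act_mult[of "inv g \<otimes> inv h" h z]
  by (simp add: C_eq inv_mult_group m_assoc)

text \<open>For each \<open>c\<close> the point \<open>p\<close> has a second name, with coefficient
  \<open>g \<phi>(c)\<close> and tail \<open>c^-1 y\<close>. Passing to it from \<open>q\<close>
  changes the coefficient and the tail separately; \<open>D_lip1\<close> and \<open>D_lip2\<close>
  pay for the two changes.\<close>

lemma C_lip2:
  assumes "z \<in> S" "p \<in> Z" "q \<in> Z"
  shows "C z p \<le> C z q + E q p"
proof -
  obtain g y h x where p: "p = (m, g) # y" "g \<in> carrier G" "y \<in> S"
    and q: "q = (m, h) # x" "h \<in> carrier G" "x \<in> S" using assms by (elim Z_E)
  have "C z p - C z q \<le> E q p" unfolding p(1) q(1)
  proof (rule E_ge)
    fix c assume c: "c \<in> A"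
    note cc = A_carr[OF c] \<phi>_carr[OF c]
    let ?u = "act (inv (g \<otimes> \<phi> c)) z" and ?v = "act (inv h) z"
    have u: "?u = act (inv (\<phi> c)) (act (inv g) z)"
      using cc p assms act_mult[of "inv (\<phi> c)" "inv g" z] by (simp add: inv_mult_group)
    have S: "?u \<in> S" "?v \<in> S" using act_closed assms cc p q by auto
    have 1: "\<rho> ?u ?v \<le> d h (g \<otimes> \<phi> c)"
      using \<rho>_act2[of "inv (g \<otimes> \<phi> c)" "inv h" z] d_inv[of "g \<otimes> \<phi> c" h] d_sym[of h] cc p q assms
      by simp
    have 2: "C z p = D ?u (act (inv c) y)"
      using D_act[of ?u "act (inv c) y" c] u S act_inv act_closed p cc c assms by (simp add: C_eq)
    have "D ?u (act (inv c) y) \<le> \<rho> ?u ?v + D ?v (act (inv c) y)"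
      using D_lip1 S act_closed p cc by simp
    moreover have "D ?v (act (inv c) y) \<le> D ?v x + \<rho> x (act (inv c) y)"
      using D_lip2 S act_closed p q cc by simp
    moreover have "\<rho> x (act (inv c) y) = \<rho> (act c x) y"
      using \<rho>_act[of c x "act (inv c) y"] act_inv act_closed p q cc by simp
    ultimately show "C z ((m, g) # y) - C z ((m, h) # x) \<le> d h (g \<otimes> \<phi> c) + \<rho> (act c x) y"
      using 1 2 p(1) by (simp add: C_eq)
  qed
  then show ?thesis by linarith
qed

lemma \<rho>'_pm: "pseudometric_on (S \<union> Z) \<rho>'"
  unfolding \<rho>'_def
proof (rule glue_pseudometric[OF S_ne S_Z pm E_pm])
  fix z z' p assume z: "z \<in> S" and "p \<in> Z"
  then obtain g y where p: "p = (m, g) # y" "g \<in> carrier G" "y \<in> S" by (elim Z_E)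
  show "0 \<le> C z p" using D_nonneg act_closed z p by (simp add: C_eq)
  assume z': "z' \<in> S"
  have "\<rho> (act (inv g) z) (act (inv g) z') = \<rho> z z'" using \<rho>_act z z' p by simp
  then show "C z p \<le> \<rho> z z' + C z' p" "\<rho> z z' \<le> C z p + C z' p"
    using D_lip1[of "act (inv g) z" "act (inv g) z'" y] D_kat1[of "act (inv g) z" "act (inv g) z'" y]
      act_closed z z' p by (auto simp: C_eq)
qed (rule C_lip2)

lemma \<rho>'_simps:
  "z \<in> S \<Longrightarrow> w \<in> S \<Longrightarrow> \<rho>' z w = \<rho> z w"
  "z \<in> S \<Longrightarrow> \<rho>' z ((m, g) # y) = C z ((m, g) # y)"
  "z \<in> S \<Longrightarrow> \<rho>' ((m, g) # y) z = C z ((m, g) # y)"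
  "\<rho>' ((m, g) # y) ((m, h) # x) = min (E ((m, g) # y) ((m, h) # x))
     (INF z\<in>S. C z ((m, g) # y) + C z ((m, h) # x))"
  using Z_disj by (auto simp: \<rho>'_def glue_def)

lemma \<rho>'_Z_ge:
  assumes "\<And>c. c \<in> A \<Longrightarrow> r \<le> d g (h \<otimes> \<phi> c) + \<rho> (act c y) x"
    and "\<And>z. z \<in> S \<Longrightarrow> r \<le> C z ((m, g) # y) + C z ((m, h) # x)"
  shows "r \<le> \<rho>' ((m, g) # y) ((m, h) # x)"
  unfolding \<rho>'_simps
proof (rule min.boundedI)
  show "r \<le> E ((m, g) # y) ((m, h) # x)" by (rule E_ge) (rule assms)
  show "r \<le> (INF z\<in>S. C z ((m, g) # y) + C z ((m, h) # x))"
    by (rule cINF_greatest[OF S_ne]) (rule assms)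
qed

lemma S'_cases:
  assumes "p \<in> S \<union> Z"
  obtains "p \<in> S" | g y where "p = (m, g) # y" "g \<in> carrier G" "y \<in> S"
  using assms by (auto simp: Z_def)

lemma \<rho>'_act:
  assumes k: "k \<in> carrier G" and "p \<in> S \<union> Z" "q \<in> S \<union> Z"
  shows "\<rho>' (act k p) (act k q) = \<rho>' p q"
  using assms(2)
proof (cases rule: S'_cases)
  case p: 1
  from assms(3) show ?thesis
  proof (cases rule: S'_cases)
    case 1 then show ?thesis using p \<rho>'_simps \<rho>_act act_closed k by simp
  next
    case (2 g y) then show ?thesis using p \<rho>'_simps C_shift act_closed k by simp
  qed
next
  case p: (2 g y)
  from assms(3) show ?thesis
  proof (cases rule: S'_cases)
    case 1 then show ?thesis using p \<rho>'_simps C_shift act_closed k by simp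
  next
    case q: (2 h x)
    have "E ((m, k \<otimes> g) # y) ((m, k \<otimes> h) # x) = E ((m, g) # y) ((m, h) # x)"
      unfolding E_def using k p q \<phi>_carr d_left by (intro INF_cong) (auto simp: m_assoc)
    \<comment> \<open>Translation by \<open>k\<close> permutes \<open>S\<close>, so the infimum over
      detours can be reindexed.\<close>
    moreover have "(INF z\<in>S. C z ((m, k \<otimes> g) # y) + C z ((m, k \<otimes> h) # x)) =
      (INF z\<in>S. C z ((m, g) # y) + C z ((m, h) # x))"
    proof -
      have "z \<in> act k ` S" if "z \<in> S" for z
        using act_inv(2)[OF k that] act_closed[of "inv k" z] k that by (metis image_eqI inv_closed)
      then have "act k ` S = S" using act_closed k by blast
      then have "(INF z\<in>S. C z ((m, k \<otimes> g) # y) + C z ((m, k \<otimes> h) # x)) =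
        (INF z\<in>act k ` S. C z ((m, k \<otimes> g) # y) + C z ((m, k \<otimes> h) # x))" by simp
      also have "\<dots> = (INF z\<in>S. C (act k z) ((m, k \<otimes> g) # y) + C (act k z) ((m, k \<otimes> h) # x))"
        by (simp add: image_comp)
      also have "\<dots> = (INF z\<in>S. C z ((m, g) # y) + C z ((m, h) # x))"
        using C_shift k p q by (intro INF_cong) auto
      finally show ?thesis .
    qed
    ultimately show ?thesis using p q \<rho>'_simps by simp
  qed
qed

text \<open>On a new point \<open>k\<close> acts through the coefficient, so \<open>E\<close> with
  \<open>c = \<one>\<close> bounds the displacement by \<open>d (k \<otimes> g) g\<close>, and right
  invariance of \<open>d\<close> removes \<open>g\<close>.\<close>

lemma \<rho>'_disp:
  assumes "k \<in> carrier G" "p \<in> S \<union> Z"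
  shows "\<rho>' (act k p) p \<le> d k \<one>"
  using assms(2)
proof (cases rule: S'_cases)
  case 1 then show ?thesis using \<rho>'_simps \<rho>_disp act_closed assms by simp
next
  case (2 g y)
  have "E ((m, k \<otimes> g) # y) ((m, g) # y) \<le> d (k \<otimes> g) g"
    using E_le[of "k \<otimes> g" y g y \<one>] 2 assms oneA \<phi>_one act_one \<rho>_self by simp
  also have "\<dots> = d k \<one>" using d_right[of g k \<one>] 2 assms by simp
  finally show ?thesis using 2 \<rho>'_simps by simp
qed

section \<open>The enlarged graph of \<open>t\<close>\<close>

lemma R'_cases:
  assumes "(u, v) \<in> R'"
  obtains "(u, v) \<in> R" | a y where "a \<in> A" "y \<in> S" "u = act a y" "v = (m, \<phi> a) # y"
  using assms by (auto simp: R'_def)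

lemma R'_isom_mixed:
  assumes "(x, y) \<in> R" "a \<in> A" "u \<in> S"
  shows "\<rho>' x (act a u) = \<rho>' y ((m, \<phi> a) # u)" "\<rho>' (act a u) x = \<rho>' ((m, \<phi> a) # u) y"
proof -
  have "C y ((m, \<phi> a) # u) = \<rho> x (act a u)"
    using D_act'[of y u a] D_R[of x y "act a u"] assms R_S A_carr act_closed by (simp add: C_eq)
  then show "\<rho>' x (act a u) = \<rho>' y ((m, \<phi> a) # u)" "\<rho>' (act a u) x = \<rho>' ((m, \<phi> a) # u) y"
    using \<rho>'_simps assms R_S A_carr act_closed \<rho>_sym by auto
qed

text \<open>The two new points are the values of \<open>t\<close> at \<open>a y\<close> and
  \<open>b x\<close>. Renaming by \<open>inv b \<otimes> a\<close> equalises their coefficients, so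
  \<open>E\<close> gives the upper bound. Conversely, the direct route is long enough because \<phi>
  is isometric and \<open>a\<close>, \<open>b \<otimes> c\<close> send \<open>y\<close> to points at
  most \<open>d a (b \<otimes> c)\<close> apart; the route through old points is
  \<open>D_kat2\<close>.\<close>

lemma R'_isom_new:
  assumes "a \<in> A" "y \<in> S" "b \<in> A" "x \<in> S"
  shows "\<rho>' (act a y) (act b x) = \<rho>' ((m, \<phi> a) # y) ((m, \<phi> b) # x)"
proof (rule antisym)
  note cc = A_carr[OF assms(1)] \<phi>_carr[OF assms(1)] A_carr[OF assms(3)] \<phi>_carr[OF assms(3)]
  show "\<rho>' (act a y) (act b x) \<le> \<rho>' ((m, \<phi> a) # y) ((m, \<phi> b) # x)"
  proof (rule \<rho>'_Z_ge)
    fix c assume c: "c \<in> A"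
    have "d (\<phi> a) (\<phi> b \<otimes> \<phi> c) = d a (b \<otimes> c)" using \<phi>_isom \<phi>_mult multA assms c by metis
    moreover have "\<rho> (act a y) (act (b \<otimes> c) y) \<le> d a (b \<otimes> c)"
      using \<rho>_act2 assms cc c A_carr by simp
    moreover have "\<rho> (act (b \<otimes> c) y) (act b x) = \<rho> (act c y) x"
      using \<rho>_act act_mult act_closed assms cc c A_carr by simp
    moreover have "\<rho> (act a y) (act b x) \<le> \<rho> (act a y) (act (b \<otimes> c) y) + \<rho> (act (b \<otimes> c) y) (act b x)"
      using \<rho>_tri act_closed assms cc c A_carr by simp
    ultimately show "\<rho>' (act a y) (act b x) \<le> d (\<phi> a) (\<phi> b \<otimes> \<phi> c) + \<rho> (act c y) x"
      using \<rho>'_simps act_closed assms cc by simp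
  next
    fix z assume "z \<in> S"
    then show "\<rho>' (act a y) (act b x) \<le> C z ((m, \<phi> a) # y) + C z ((m, \<phi> b) # x)"
      using D_kat2[of z "act a y" "act b x"] D_act' assms cc act_closed \<rho>'_simps by (simp add: C_eq)
  qed
  let ?c = "inv b \<otimes> a"
  have c: "?c \<in> A" "b \<otimes> ?c = a" using assms multA invA cc by (auto simp flip: m_assoc)
  have "\<phi> b \<otimes> \<phi> ?c = \<phi> a" using \<phi>_mult[OF assms(3) c(1)] c(2) by simp
  moreover have "\<rho> (act ?c y) x = \<rho> (act a y) (act b x)"
    using \<rho>_act[of b "act ?c y" x] act_mult[of b ?c y] act_closed c assms cc by simp
  ultimately have "E ((m, \<phi> a) # y) ((m, \<phi> b) # x) \<le> \<rho> (act a y) (act b x)"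
    using E_le[of "\<phi> a" y "\<phi> b" x ?c] c assms cc d_self by simp
  then show "\<rho>' ((m, \<phi> a) # y) ((m, \<phi> b) # x) \<le> \<rho>' (act a y) (act b x)"
    using \<rho>'_simps act_closed assms cc by simp
qed

lemma new_stage: "stage G d A B \<phi> K (S \<union> Z) \<rho>' R'"
proof (intro stage.intro stage_axioms.intro hnn_base_axioms \<rho>'_pm)
  show "S \<union> Z \<noteq> {}" using S_ne by simp
  show "\<exists>n g w. x = (n, g) # w \<and> g \<in> carrier G" if "x \<in> S \<union> Z" for x
    using that S_form by (auto simp: Z_def)
  show "act g x \<in> S \<union> Z" if "g \<in> carrier G" "x \<in> S \<union> Z" for g x
    using that act_closed by (auto simp: Z_def)
  show "R' \<subseteq> (S \<union> Z) \<times> (S \<union> Z)"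
    using R_sub act_closed A_carr \<phi>_carr by (auto simp: R'_def Z_def)
  show "\<rho>' x y \<le> K" if "(x, y) \<in> R'" for x y
    using that
  proof (cases rule: R'_cases)
    case 1 then show ?thesis using R_K R_S \<rho>'_simps by simp
  next
    \<comment> \<open>Invariance turns the distance from \<open>a u\<close> to
      \<open>\<phi>(a) t u\<close> into \<open>D (a u) (a u)\<close>.\<close>
    case (2 a u) then show ?thesis
      using D_act'[of "act a u" u a] D_diag[of "act a u"] \<rho>'_simps A_carr act_closed by (simp add: C_eq)
  qed
  show "\<rho>' x x' = \<rho>' y y'" if "(x, y) \<in> R'" "(x', y') \<in> R'" for x y x' y'
    using that(1)
  proof (cases rule: R'_cases)
    case xy: 1
    from that(2) show ?thesis
    proof (cases rule: R'_cases)
      case 1 then show ?thesis using xy R_isom R_S \<rho>'_simps by simp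
    next
      case (2 a u) then show ?thesis using xy R'_isom_mixed by simp
    qed
  next
    case xy: (2 a u)
    from that(2) show ?thesis
    proof (cases rule: R'_cases)
      case 1 then show ?thesis using xy R'_isom_mixed by simp
    next
      case (2 b v) then show ?thesis using xy R'_isom_new by simp
    qed
  qed
  show "(act a x, act (\<phi> a) y) \<in> R'" if "(x, y) \<in> R'" "a \<in> A" for x y a
    using that(1)
  proof (cases rule: R'_cases)
    case 1 then show ?thesis using R_act that by (simp add: R'_def)
  next
    case (2 b u)
    then have "act a x = act (a \<otimes> b) u" "act (\<phi> a) y = (m, \<phi> (a \<otimes> b)) # u"
      using that A_carr act_mult \<phi>_mult by auto
    then show ?thesis using multA that 2 unfolding R'_def by blast
  qed
qed (rule \<rho>'_act \<rho>'_disp; assumption)+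

section \<open>The domain of the enlarged graph and separation estimates\<close>

lemma Domain_R': "Domain R' = S"
proof -
  have "y \<in> Domain R'" if "y \<in> S" for y
  proof -
    have "(act \<one> y, (m, \<phi> \<one>) # y) \<in> R'" using that oneA unfolding R'_def by blast
    then show ?thesis using act_one that by auto
  qed
  moreover have "Domain R' \<subseteq> S" using R_S act_closed A_carr by (auto simp: R'_def)
  ultimately show ?thesis by blast
qed

text \<open>Being at positive distance from the old domain, \<open>y\<close> is not in it, so
  \<open>y'\<close> is a new point. A \<open>K\<close>-jump to an old point costs \<open>K\<close>,
  and a jump along \<open>R\<close> starts in the old domain, already \<epsilon> away from
  \<open>y\<close>.\<close>

lemma far_from_old:
  assumes "0 < \<epsilon>" "\<epsilon> \<le> K" "(y, y') \<in> R'" "g \<in> carrier G" "\<And>z. z \<in> Domain R \<Longrightarrow> \<epsilon> \<le> \<rho> y z"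
  obtains a u where "a \<in> A" "u \<in> S" "y' = (m, \<phi> a) # u"
    "\<And>z. z \<in> S \<Longrightarrow> \<epsilon> \<le> C z ((m, g \<otimes> \<phi> a) # u)"
  using assms(3)
proof (cases rule: R'_cases)
  case 1
  then have "\<rho> y y = 0" "y \<in> Domain R" using R_S \<rho>_self by auto
  then show ?thesis using assms by fastforce
next
  case (2 a u)
  have "\<epsilon> \<le> C z ((m, g \<otimes> \<phi> a) # u)" if z: "z \<in> S" for z
    unfolding C_eq
  proof (rule D_far)
    show "act (inv (g \<otimes> \<phi> a)) z \<in> S" "u \<in> S" using 2 z \<phi>_carr assms act_closed by auto
    fix y0 y1 assume j: "(y0, y1) \<in> R"
    have "\<epsilon> \<le> \<rho> (act a u) (act a y0)" using assms(5) R_act[OF j 2(1)] 2 by blast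
    also have "\<dots> = \<rho> y0 u" using \<rho>_act \<rho>_sym R_S j 2 A_carr by simp
    finally show "\<epsilon> \<le> \<rho> (act (inv (g \<otimes> \<phi> a)) z) y1 + \<rho> y0 u"
      using \<rho>_nonneg[of "act (inv (g \<otimes> \<phi> a)) z" y1] R_S j 2 z \<phi>_carr assms act_closed
      by (simp add: add_increasing)
  qed (rule assms)
  then show ?thesis using that 2 by blast
qed

lemma far_step:
  assumes "0 < \<epsilon>" "\<epsilon> \<le> K" "(y, y') \<in> R'" "g \<in> carrier G" "\<forall>z\<in>Domain R. \<epsilon> \<le> \<rho> y z"
  shows "(\<forall>z\<in>S. \<epsilon> \<le> \<rho>' (act g y') z) \<and>
    ((\<forall>b\<in>B. \<epsilon> \<le> d g b) \<longrightarrow> (\<forall>z\<in>Range R'. \<epsilon> \<le> \<rho>' (act g y') z))"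
proof -
  obtain a u where a: "a \<in> A" "u \<in> S" "y' = (m, \<phi> a) # u"
    and far: "\<And>z. z \<in> S \<Longrightarrow> \<epsilon> \<le> C z ((m, g \<otimes> \<phi> a) # u)"
    using far_from_old assms by metis
  have 1: "\<epsilon> \<le> \<rho>' (act g y') z" if "z \<in> S" for z using far \<rho>'_simps that a by simp
  have "\<epsilon> \<le> \<rho>' (act g y') z" if g: "\<forall>b\<in>B. \<epsilon> \<le> d g b" and z: "z \<in> Range R'" for z
  proof -
    from z obtain x where "(x, z) \<in> R'" by blast
    then show ?thesis
    proof (cases rule: R'_cases)
      case 1: 1 then show ?thesis using \<open>\<And>z. z \<in> S \<Longrightarrow> \<epsilon> \<le> \<rho>' (act g y') z\<close> R_S by blast
    next
      case (2 b v)
      have "\<epsilon> \<le> \<rho>' ((m, g \<otimes> \<phi> a) # u) ((m, \<phi> b) # v)"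
      proof (rule \<rho>'_Z_ge)
        fix c assume c: "c \<in> A"
        note cc = c a(1) 2(1)
        \<comment> \<open>After cancelling \<open>\<phi> a\<close> on the right, the direct route
          compares \<open>g\<close> with \<phi> (b c a^-1), an element of \<open>B\<close>.\<close>
        have bc: "b \<otimes> c \<otimes> inv a \<in> A" using cc multA invA by simp
        have "\<phi> (b \<otimes> c \<otimes> inv a) = \<phi> b \<otimes> \<phi> c \<otimes> inv (\<phi> a)"
          using cc multA invA \<phi>_mult \<phi>_inv by simp
        then have "d g (\<phi> b \<otimes> \<phi> c \<otimes> inv (\<phi> a)) \<ge> \<epsilon>" using g \<phi>_B[OF bc] by metis
        moreover have "d g (\<phi> b \<otimes> \<phi> c \<otimes> inv (\<phi> a)) = d (g \<otimes> \<phi> a) (\<phi> b \<otimes> \<phi> c)"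
          using d_right[of "\<phi> a" g "\<phi> b \<otimes> \<phi> c \<otimes> inv (\<phi> a)"] cc \<phi>_carr assms by (simp add: m_assoc)
        ultimately show "\<epsilon> \<le> d (g \<otimes> \<phi> a) (\<phi> b \<otimes> \<phi> c) + \<rho> (act c u) v"
          using \<rho>_nonneg[of "act c u" v] act_closed a 2 c A_carr by simp
      next
        fix z assume z: "z \<in> S"
        have "0 \<le> C z ((m, \<phi> b) # v)"
          using D_nonneg act_closed z 2 \<phi>_carr by (simp add: C_eq)
        then show "\<epsilon> \<le> C z ((m, g \<otimes> \<phi> a) # u) + C z ((m, \<phi> b) # v)" using far[OF z] by simp
      qed
      then show ?thesis using a 2 by simp
    qed
  qed
  then show ?thesis using 1 by blast
qed

text \<open>Serves points that wait during a step in the other direction. The values newly given to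
  \<open>t\<close> stay \<epsilon> away, because \<open>R_act\<close> carries the hypothesis to all
  translates of the old range by \<open>B\<close>.\<close>

lemma far_keep:
  assumes "\<epsilon> \<le> K" "y \<in> S" "\<forall>z\<in>Range R. \<epsilon> \<le> \<rho> y z" "z \<in> Range R'"
  shows "\<epsilon> \<le> \<rho>' y z"
proof -
  obtain x where "(x, z) \<in> R'" using assms by blast
  then show ?thesis
  proof (cases rule: R'_cases)
    case 1 then show ?thesis using assms R_S \<rho>'_simps by auto
  next
    case (2 a u)
    have "\<epsilon> \<le> D (act (inv (\<phi> a)) y) u"
    proof (rule D_far)
      show "act (inv (\<phi> a)) y \<in> S" "u \<in> S" using 2 \<phi>_carr assms act_closed by auto
      fix y0 y1 assume j: "(y0, y1) \<in> R"
      have "\<epsilon> \<le> \<rho> y (act (\<phi> a) y1)" using assms(3) R_act[OF j 2(1)] by blast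
      also have "\<dots> = \<rho> (act (inv (\<phi> a)) y) y1" using \<rho>_shift 2 \<phi>_carr R_S j assms by simp
      finally show "\<epsilon> \<le> \<rho> (act (inv (\<phi> a)) y) y1 + \<rho> y0 u"
        using \<rho>_nonneg[of y0 u] R_S j 2 by simp
    qed (rule assms)
    then show ?thesis using \<rho>'_simps assms 2 by (simp add: C_eq)
  qed
qed

lemma step_exists:
  "\<exists>S' \<rho>'' R''. stage G d A B \<phi> K S' \<rho>'' R'' \<and> (\<forall>x\<in>S'. fst (hd x) < Suc m) \<and>
     step_rel G d B K S \<rho> R S' \<rho>'' R''"
proof (intro exI conjI)
  show "\<forall>x\<in>S \<union> Z. fst (hd x) < Suc m" using fresh by (force simp: Z_def less_Suc_eq)
  show "step_rel G d B K S \<rho> R (S \<union> Z) \<rho>' R'"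
    unfolding step_rel_def
    using \<rho>'_simps(1) Domain_R' far_step far_keep by (auto simp: R'_def)
qed (rule new_stage)

end

section \<open>Iterating the extension\<close>

text \<open>\<open>True\<close> stands for \<open>t\<close> and \<open>False\<close> for
  \<open>t^-1\<close>.\<close>

definition dir :: "bool \<Rightarrow> ('x \<times> 'x) set \<Rightarrow> ('x \<times> 'x) set" where
  "dir e R = (if e then R else R\<inverse>)"

context hnn_base
begin

abbreviation x0 :: "(nat \<times> 'a) list" where "x0 \<equiv> [(0, \<one>)]"

text \<open>The elements that can be moved across the letter \<open>e\<close> from its left:
  \<open>\<phi>(a) t = t a\<close> and \<open>a t^-1 = t^-1 \<phi>(a)\<close>.\<close>

definition sub :: "bool \<Rightarrow> 'a set" where "sub e = (if e then B else A)"

text \<open>Britton's condition. With a leading coefficient \<open>g\<close>, a list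
  \<open>[(e1, g1), (e2, g2), ...]\<close> stands for \<open>g t^e1 g1 t^e2 g2 ...\<close>; excluded
  are the pinches \<open>t a t^-1\<close> with \<open>a\<close> in \<open>A\<close> and
  \<open>t^-1 b t\<close> with \<open>b\<close> in \<open>B\<close>.\<close>

fun reduced :: "(bool \<times> 'a) list \<Rightarrow> bool" where
  "reduced ((e, g) # (e', g') # l) \<longleftrightarrow> (e \<noteq> e' \<longrightarrow> g \<notin> sub e') \<and> reduced ((e', g') # l)"
| "reduced _ \<longleftrightarrow> True"

text \<open>A relation, since \<open>R\<close> may offer several values of \<open>t\<close> at
  mutual distance zero. Words act from their right end, starting at the base point.\<close>

primrec reaches ::
  "((nat \<times> 'a) list \<times> (nat \<times> 'a) list) set \<Rightarrow> (bool \<times> 'a) list \<Rightarrow> 'a \<Rightarrow> (nat \<times> 'a) list \<Rightarrow> bool" where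
  "reaches R [] g x \<longleftrightarrow> x = act g x0"
| "reaches R (p # l) g x \<longleftrightarrow> (\<exists>y y'. reaches R l (snd p) y \<and> (y, y') \<in> dir (fst p) R \<and> x = act g y')"

lemma initial_stage:
  "stage G d A B \<phi> K {[(0, g)] | g. g \<in> carrier G} (\<lambda>x y. d (snd (hd x)) (snd (hd y))) {}"
proof (intro stage.intro stage_axioms.intro hnn_base_axioms)
  show "pseudometric_on {[(0, g)] | g. g \<in> carrier G} (\<lambda>x y. d (snd (hd x)) (snd (hd y)))"
    by (rule pseudometric_onI) (use d_self d_sym d_triangle in auto)
  show "d (snd (hd (act g x))) (snd (hd x)) \<le> d g \<one>"
    if "g \<in> carrier G" "x \<in> {[(0, g)] | g. g \<in> carrier G}" for g and x :: "(nat \<times> 'a) list"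
    using that d_right[of _ g \<one>] by auto
  show "d (snd (hd (act g x))) (snd (hd (act g y))) = d (snd (hd x)) (snd (hd y))"
    if "g \<in> carrier G" "x \<in> {[(0, g)] | g. g \<in> carrier G}" "y \<in> {[(0, g)] | g. g \<in> carrier G}"
    for g and x y :: "(nat \<times> 'a) list"
    using that d_left by auto
qed auto

text \<open>Even steps complete the domain of \<open>t\<close>, odd ones that of
  \<open>t^-1\<close>, by way of the converse relation and the other subgroup.\<close>

definition steps where
  "steps n S \<rho> R S' \<rho>' R' \<longleftrightarrow>
     step_rel G d (sub (even n)) K S \<rho> (dir (even n) R) S' \<rho>' (dir (even n) R')"

lemma chain_exists:
  obtains S \<rho> R where "S 0 = {[(0, g)] | g. g \<in> carrier G}"
    "\<rho> 0 = (\<lambda>x y. d (snd (hd x)) (snd (hd y)))" "R 0 = {}"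
    "\<And>n. stage G d A B \<phi> K (S n) (\<rho> n) (R n)"
    "\<And>n. steps n (S n) (\<rho> n) (R n) (S (Suc n)) (\<rho> (Suc n)) (R (Suc n))"
proof -
  \<comment> \<open>The bound \<open>Suc n\<close> on the tags frees \<open>Suc n\<close> as the tag
    of step \<open>n\<close>. The clause for \<open>n = 0\<close> records the initial stage, which
    the choice principle would otherwise forget.\<close>
  define P where "P n = (\<lambda>(S, \<rho>, R). stage G d A B \<phi> K S \<rho> R \<and> (\<forall>x\<in>S. fst (hd x) < Suc n) \<and>
    (n = 0 \<longrightarrow> S = {[(0, g)] | g. g \<in> carrier G} \<and>
       \<rho> = (\<lambda>x y. d (snd (hd x)) (snd (hd y))) \<and> R = {}))" for n :: nat
  define Q where "Q n = (\<lambda>(S, \<rho>, R) (S', \<rho>', R'). steps n S \<rho> R S' \<rho>' R')" for n :: nat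
  have "\<exists>f. \<forall>n. P n (f n) \<and> Q n (f n) (f (Suc n))"
  proof (rule dependent_nat_choice)
    show "\<exists>s. P 0 s"
      by (rule exI[of _ "({[(0, g)] | g. g \<in> carrier G}, (\<lambda>x y. d (snd (hd x)) (snd (hd y))), {})"])
        (use initial_stage in \<open>auto simp: P_def\<close>)
  next
    fix s n assume P: "P n s"
    obtain S \<rho> R where s: "s = (S, \<rho>, R)" by (cases s)
    interpret st: stage G d A B \<phi> K S \<rho> R using P s by (simp add: P_def)
    have fr: "\<And>x. x \<in> S \<Longrightarrow> fst (hd x) < Suc n" using P s by (simp add: P_def)
    show "\<exists>s'. P (Suc n) s' \<and> Q n s s'"
    proof (cases "even n")
      case True
      interpret fs: fresh_stage G d A B \<phi> K S \<rho> R "Suc n" by unfold_locales (rule fr)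
      obtain S' \<rho>' R' where "stage G d A B \<phi> K S' \<rho>' R'" "\<forall>x\<in>S'. fst (hd x) < Suc (Suc n)"
        "step_rel G d B K S \<rho> R S' \<rho>' R'" using fs.step_exists by blast
      then have "P (Suc n) (S', \<rho>', R') \<and> Q n s (S', \<rho>', R')"
        using True by (simp add: P_def Q_def s steps_def dir_def sub_def)
      then show ?thesis by blast
    next
      case False
      let ?\<psi> = "inv_into A \<phi>"
      have \<psi>: "?\<psi> b \<in> A \<and> \<phi> (?\<psi> b) = b" if "b \<in> B" for b
        using bij that by (auto simp: bij_betw_def inv_into_into f_inv_into_f)
      have \<phi>: "\<phi> a \<in> B \<and> ?\<psi> (\<phi> a) = a" if "a \<in> A" for a
        using bij that by (auto simp: bij_betw_def inv_into_f_f)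
      interpret fs: fresh_stage G d B A ?\<psi> K S \<rho> "R\<inverse>" "Suc n"
        by (intro fresh_stage.intro fresh_stage_axioms.intro st.stage_swap \<psi> fr)
      obtain S' \<rho>' R' where st': "stage G d B A ?\<psi> K S' \<rho>' R'" and *: "\<forall>x\<in>S'. fst (hd x) < Suc (Suc n)"
        "step_rel G d A K S \<rho> (R\<inverse>) S' \<rho>' R'" using fs.step_exists by blast
      have "stage G d A B \<phi> K S' \<rho>' (R'\<inverse>)" using stage.stage_swap[OF st' \<phi>] .
      then have "P (Suc n) (S', \<rho>', R'\<inverse>) \<and> Q n s (S', \<rho>', R'\<inverse>)"
        using False * by (simp add: P_def Q_def s steps_def dir_def sub_def)
      then show ?thesis by blast
    qed
  qed
  then obtain f where f: "\<And>n. P n (f n)" "\<And>n. Q n (f n) (f (Suc n))" by blast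
  show ?thesis
    by (rule that[of "\<lambda>n. fst (f n)" "\<lambda>n. fst (snd (f n))" "\<lambda>n. snd (snd (f n))"])
      (use f(1)[of 0] f in \<open>auto simp: P_def Q_def split_beta\<close>)
qed

end

section \<open>The union of the stages\<close>

locale stage_chain = hnn_base G d A B \<phi> K
  for G :: "('a, 'b) monoid_scheme" (structure) and d A B \<phi> K +
  fixes S and \<rho> and R
  assumes S0: "S 0 = {[(0, g)] | g. g \<in> carrier G}"
    and \<rho>0: "\<rho> 0 = (\<lambda>x y. d (snd (hd x)) (snd (hd y)))"
    and R0: "R 0 = {}"
    and st: "\<And>n. stage G d A B \<phi> K (S n) (\<rho> n) (R n)"
    and steps: "\<And>n. steps n (S n) (\<rho> n) (R n) (S (Suc n)) (\<rho> (Suc n)) (R (Suc n))"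
begin

lemma
  S_Suc: "S n \<subseteq> S (Suc n)" and step_restrict: "x \<in> S n \<Longrightarrow> y \<in> S n \<Longrightarrow> \<rho> (Suc n) x y = \<rho> n x y"
  and R_Suc: "R n \<subseteq> R (Suc n)" and Domain_Suc: "Domain (dir (even n) (R (Suc n))) = S n"
  using steps[of n] by (auto simp: steps_def step_rel_def dir_def split: if_splits)

lemma S_mono: "m \<le> n \<Longrightarrow> S m \<subseteq> S n"
  using S_Suc by (rule lift_Suc_mono_le)

lemma R_mono: "m \<le> n \<Longrightarrow> R m \<subseteq> R n"
  using R_Suc by (rule lift_Suc_mono_le)

lemma \<rho>_stable: "m \<le> n \<Longrightarrow> x \<in> S m \<Longrightarrow> y \<in> S m \<Longrightarrow> \<rho> n x y = \<rho> m x y"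
proof (induction n rule: dec_induct)
  case (step n)
  then have "x \<in> S n" "y \<in> S n" using S_mono by blast+
  then show ?case using step step_restrict by simp
qed simp

definition S\<^sub>\<omega> where "S\<^sub>\<omega> = (\<Union>n. S n)"
definition R\<^sub>\<omega> where "R\<^sub>\<omega> = (\<Union>n. R n)"
definition \<rho>\<^sub>\<omega> where "\<rho>\<^sub>\<omega> x y = \<rho> (LEAST n. x \<in> S n \<and> y \<in> S n) x y"

lemma \<rho>\<^sub>\<omega>_eq: "x \<in> S n \<Longrightarrow> y \<in> S n \<Longrightarrow> \<rho>\<^sub>\<omega> x y = \<rho> n x y"
proof -
  assume n: "x \<in> S n" "y \<in> S n"
  define k where "k = (LEAST n. x \<in> S n \<and> y \<in> S n)"
  have "k \<le> n" "x \<in> S k \<and> y \<in> S k"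
    unfolding k_def using n by (auto intro: Least_le LeastI2[of "\<lambda>n. x \<in> S n \<and> y \<in> S n" n])
  then show ?thesis using \<rho>_stable by (simp add: \<rho>\<^sub>\<omega>_def k_def)
qed

lemma S\<^sub>\<omega>_common:
  assumes "x \<in> S\<^sub>\<omega>" "y \<in> S\<^sub>\<omega>" "z \<in> S\<^sub>\<omega>"
  obtains n where "x \<in> S n" "y \<in> S n" "z \<in> S n"
proof -
  obtain i j k where "x \<in> S i" "y \<in> S j" "z \<in> S k" using assms by (auto simp: S\<^sub>\<omega>_def)
  then show ?thesis
    using that[of "max i (max j k)"] S_mono[of i "max i (max j k)"] S_mono[of j "max i (max j k)"]
      S_mono[of k "max i (max j k)"] by (meson max.cobounded1 max.cobounded2 max.coboundedI2 subset_iff)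
qed

lemma R\<^sub>\<omega>_common:
  assumes "p \<in> R\<^sub>\<omega>" "q \<in> R\<^sub>\<omega>"
  obtains n where "p \<in> R n" "q \<in> R n"
proof -
  obtain i j where "p \<in> R i" "q \<in> R j" using assms by (auto simp: R\<^sub>\<omega>_def)
  then show ?thesis
    using that[of "max i j"] R_mono[of i "max i j"] R_mono[of j "max i j"] by auto
qed

text \<open>Every axiom involves finitely many points or pairs, which lie in a common finite stage,
  where it is known.\<close>

lemma limit_stage: "stage G d A B \<phi> K S\<^sub>\<omega> \<rho>\<^sub>\<omega> R\<^sub>\<omega>"
proof (intro stage.intro stage_axioms.intro hnn_base_axioms)
  note s = stage.S_form[OF st] stage.act_closed[OF st] stage.\<rho>_act[OF st] stage.\<rho>_disp[OF st]
    stage.R_S[OF st] stage.R_K[OF st] stage.R_isom[OF st] stage.R_act[OF st]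
  show "S\<^sub>\<omega> \<noteq> {}" using stage.S_ne[OF st] by (auto simp: S\<^sub>\<omega>_def)
  show "\<exists>n g w. x = (n, g) # w \<and> g \<in> carrier G" if "x \<in> S\<^sub>\<omega>" for x
    using that s(1) by (auto simp: S\<^sub>\<omega>_def)
  show closed: "act g x \<in> S\<^sub>\<omega>" if "g \<in> carrier G" "x \<in> S\<^sub>\<omega>" for g x
    using that s(2) by (auto simp: S\<^sub>\<omega>_def)
  show "pseudometric_on S\<^sub>\<omega> \<rho>\<^sub>\<omega>"
  proof (rule pseudometric_onI)
    show "\<rho>\<^sub>\<omega> x x = 0" if "x \<in> S\<^sub>\<omega>" for x
      using that by (metis S\<^sub>\<omega>_common \<rho>\<^sub>\<omega>_eq stage.\<rho>_self[OF st])
    show "\<rho>\<^sub>\<omega> x y = \<rho>\<^sub>\<omega> y x" if "x \<in> S\<^sub>\<omega>" "y \<in> S\<^sub>\<omega>" for x y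
      using that by (metis S\<^sub>\<omega>_common \<rho>\<^sub>\<omega>_eq stage.\<rho>_sym[OF st])
    show "\<rho>\<^sub>\<omega> x z \<le> \<rho>\<^sub>\<omega> x y + \<rho>\<^sub>\<omega> y z" if "x \<in> S\<^sub>\<omega>" "y \<in> S\<^sub>\<omega>" "z \<in> S\<^sub>\<omega>" for x y z
      using that by (metis S\<^sub>\<omega>_common \<rho>\<^sub>\<omega>_eq stage.\<rho>_tri[OF st])
  qed
  show "\<rho>\<^sub>\<omega> (act g x) (act g y) = \<rho>\<^sub>\<omega> x y" if "g \<in> carrier G" "x \<in> S\<^sub>\<omega>" "y \<in> S\<^sub>\<omega>" for g x y
    using that s(2,3) by (metis S\<^sub>\<omega>_common \<rho>\<^sub>\<omega>_eq)
  show "\<rho>\<^sub>\<omega> (act g x) x \<le> d g \<one>" if "g \<in> carrier G" "x \<in> S\<^sub>\<omega>" for g x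
    using that s(2,4) by (metis S\<^sub>\<omega>_common \<rho>\<^sub>\<omega>_eq)
  show "R\<^sub>\<omega> \<subseteq> S\<^sub>\<omega> \<times> S\<^sub>\<omega>" using s(5,6) by (auto simp: S\<^sub>\<omega>_def R\<^sub>\<omega>_def)
  show "\<rho>\<^sub>\<omega> x y \<le> K" if "(x, y) \<in> R\<^sub>\<omega>" for x y
    using that s(5-7) by (metis R\<^sub>\<omega>_common \<rho>\<^sub>\<omega>_eq)
  show "\<rho>\<^sub>\<omega> x x' = \<rho>\<^sub>\<omega> y y'" if "(x, y) \<in> R\<^sub>\<omega>" "(x', y') \<in> R\<^sub>\<omega>" for x y x' y'
    using R\<^sub>\<omega>_common[OF that] s(5,6,8) by (metis \<rho>\<^sub>\<omega>_eq)
  show "(act a x, act (\<phi> a) y) \<in> R\<^sub>\<omega>" if "(x, y) \<in> R\<^sub>\<omega>" "a \<in> A" for x y a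
    using that s(9) unfolding R\<^sub>\<omega>_def by blast
qed

lemma limit_total: "Domain (dir e R\<^sub>\<omega>) = S\<^sub>\<omega>"
proof
  show "Domain (dir e R\<^sub>\<omega>) \<subseteq> S\<^sub>\<omega>"
    using stage.R_sub[OF limit_stage] by (auto simp: dir_def split: if_splits)
  show "S\<^sub>\<omega> \<subseteq> Domain (dir e R\<^sub>\<omega>)"
  proof
    fix x assume "x \<in> S\<^sub>\<omega>"
    then obtain n where n: "x \<in> S n" by (auto simp: S\<^sub>\<omega>_def)
    \<comment> \<open>The first index from \<open>n\<close> on whose step extends the direction
      \<open>e\<close>.\<close>
    define k where "k = (if e = even n then n else Suc n)"
    have k: "n \<le> k" "even k = e" by (auto simp: k_def)
    then have "x \<in> Domain (dir e (R (Suc k)))" using S_mono[OF k(1)] n Domain_Suc[of k] by auto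
    then show "x \<in> Domain (dir e R\<^sub>\<omega>)" by (auto simp: dir_def R\<^sub>\<omega>_def split: if_splits)
  qed
qed

text \<open>\<open>e\<close> is the direction of the next letter: a point far from the domain of
  that letter is sent to a new point, far from all old ones.\<close>

definition far where "far \<epsilon> e n x \<longleftrightarrow> (\<forall>z\<in>Domain (dir e (R n)). \<epsilon> \<le> \<rho> n x z)"

lemma dir_converse: "Domain (dir (\<not> e) T) = Range (dir e T)"
  by (auto simp: dir_def)

text \<open>At a step in the opposite direction the domain of \<open>e\<close> is the range of the
  extended relation, so the last clause of \<open>step_rel\<close> applies.\<close>

lemma far_Suc:
  assumes "\<epsilon> \<le> K" "x \<in> S n" "e \<noteq> even n" "far \<epsilon> e n x"
  shows "far \<epsilon> e (Suc n) x"
proof -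
  have "\<forall>z\<in>Range (dir (even n) (R n)). \<epsilon> \<le> \<rho> n x z"
    using assms by (simp add: far_def dir_converse)
  then have "\<forall>z\<in>Range (dir (even n) (R (Suc n))). \<epsilon> \<le> \<rho> (Suc n) x z"
    using steps[of n] assms unfolding steps_def step_rel_def by blast
  then show ?thesis using assms by (simp add: far_def dir_converse)
qed

lemma far_step:
  assumes "0 < \<epsilon>" "\<epsilon> \<le> K" "e = even n" "far \<epsilon> e n y" "(y, y') \<in> dir e (R (Suc n))" "g \<in> carrier G"
  shows "\<forall>z\<in>S n. \<epsilon> \<le> \<rho> (Suc n) (act g y') z" "far \<epsilon> e (Suc n) (act g y')"
    "(\<forall>b\<in>sub e. \<epsilon> \<le> d g b) \<Longrightarrow> far \<epsilon> e' (Suc n) (act g y')"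
proof -
  have *: "(\<forall>z\<in>S n. \<epsilon> \<le> \<rho> (Suc n) (act g y') z) \<and>
      ((\<forall>b\<in>sub e. \<epsilon> \<le> d g b) \<longrightarrow> (\<forall>z\<in>Range (dir e (R (Suc n))). \<epsilon> \<le> \<rho> (Suc n) (act g y') z))"
    using steps[of n] assms unfolding steps_def step_rel_def far_def by blast
  then show 1: "\<forall>z\<in>S n. \<epsilon> \<le> \<rho> (Suc n) (act g y') z" by blast
  then show 2: "far \<epsilon> e (Suc n) (act g y')" using Domain_Suc[of n] assms by (simp add: far_def)
  show "far \<epsilon> e' (Suc n) (act g y')" if "\<forall>b\<in>sub e. \<epsilon> \<le> d g b"
  proof (cases "e' = e")
    case False
    then have "e' = (\<not> e)" by simp
    then show ?thesis using * that by (simp add: far_def dir_converse)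
  qed (use 2 in simp)
qed

lemma x0_S: "x0 \<in> S n"
  using S_mono[of 0 n] S0 by auto

text \<open>Induction from the right end of the word. The point reached is far from the domain of
  every letter that may be put in front without a pinch: the same letter again, or any letter if
  \<open>g\<close> keeps away from the subgroup. So the next letter leads to a point that is new at
  its step, hence far from the earlier stage, which contains \<open>x0\<close>.\<close>

lemma reduced_far:
  assumes \<epsilon>: "0 < \<epsilon>" "\<epsilon> \<le> K"
  shows "reduced l \<Longrightarrow> g \<in> carrier G \<Longrightarrow> snd ` set l \<subseteq> carrier G \<Longrightarrow>
    (\<And>h e b. h \<in> snd ` set l \<Longrightarrow> h \<notin> sub e \<Longrightarrow> b \<in> sub e \<Longrightarrow> \<epsilon> \<le> d h b) \<Longrightarrow>
    \<exists>n x. x \<in> S n \<and> reaches R\<^sub>\<omega> l g x \<and> (l \<noteq> [] \<longrightarrow> \<epsilon> \<le> \<rho> n x x0) \<and>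
      (\<forall>e. l = [] \<or> e = fst (hd l) \<or> (\<forall>b\<in>sub (fst (hd l)). \<epsilon> \<le> d g b) \<longrightarrow> far \<epsilon> e n x)"
proof (induction l arbitrary: g)
  case Nil
  \<comment> \<open>Vacuous, because nothing is related at stage 0.\<close>
  have "far \<epsilon> e 0 (act g x0)" for e by (simp add: far_def R0 dir_def)
  moreover have "act g x0 \<in> S 0" using Nil S0 by auto
  ultimately show ?case by auto
next
  case (Cons p l)
  obtain e h where p: "p = (e, h)" by (cases p)
  have red: "reduced l" using Cons.prems(1) p by (cases l) auto
  have "\<exists>n x. x \<in> S n \<and> reaches R\<^sub>\<omega> l h x \<and> (l \<noteq> [] \<longrightarrow> \<epsilon> \<le> \<rho> n x x0) \<and>
      (\<forall>e. l = [] \<or> e = fst (hd l) \<or> (\<forall>b\<in>sub (fst (hd l)). \<epsilon> \<le> d h b) \<longrightarrow> far \<epsilon> e n x)"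
  proof (rule Cons.IH[OF red])
    show "h \<in> carrier G" "snd ` set l \<subseteq> carrier G" using Cons.prems(3) p by auto
    fix k e b assume "k \<in> snd ` set l" "k \<notin> sub e" "b \<in> sub e"
    then show "\<epsilon> \<le> d k b" by (intro Cons.prems(4)) auto
  qed
  then obtain n y where y: "y \<in> S n" "reaches R\<^sub>\<omega> l h y" "l \<noteq> [] \<longrightarrow> \<epsilon> \<le> \<rho> n y x0"
    "\<forall>e. l = [] \<or> e = fst (hd l) \<or> (\<forall>b\<in>sub (fst (hd l)). \<epsilon> \<le> d h b) \<longrightarrow> far \<epsilon> e n y"
    by (elim exE conjE)
  have "l = [] \<or> e = fst (hd l) \<or> (\<forall>b\<in>sub (fst (hd l)). \<epsilon> \<le> d h b)"
  proof (cases l)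
    case l: (Cons q l')
    obtain e' h' where q: "q = (e', h')" by (cases q)
    have "e \<noteq> e' \<longrightarrow> h \<notin> sub e'" using Cons.prems(1) p l q by simp
    moreover have "h \<in> snd ` set (p # l)" using p by simp
    ultimately show ?thesis using Cons.prems(4) l q by (metis fst_conv list.sel(1))
  qed simp
  then have far: "far \<epsilon> e n y" using y(4) by blast
  \<comment> \<open>If step \<open>n\<close> extends the other direction, the point waits for one
    step and \<open>far_Suc\<close> keeps it far.\<close>
  define k where "k = (if e = even n then n else Suc n)"
  have k: "even k = e" "y \<in> S k" using y(1) S_Suc[of n] by (auto simp: k_def)
  have "far \<epsilon> e k y" using far far_Suc[OF \<epsilon>(2) y(1) _ far] by (auto simp: k_def)
  obtain y' where y': "(y, y') \<in> dir e (R (Suc k))" using k Domain_Suc[of k] by blast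
  note fs = far_step[OF \<epsilon> k(1)[symmetric] \<open>far \<epsilon> e k y\<close> y' Cons.prems(2)]
  have "y' \<in> S (Suc k)"
    using y' stage.R_S[OF st, of _ _ "Suc k"] by (auto simp: dir_def split: if_splits)
  then have "act g y' \<in> S (Suc k)" using stage.act_closed[OF st] Cons.prems(2) by blast
  moreover have "reaches R\<^sub>\<omega> (p # l) g (act g y')"
  proof -
    have "(y, y') \<in> dir e R\<^sub>\<omega>" using y' by (auto simp: dir_def R\<^sub>\<omega>_def split: if_splits)
    then show ?thesis using y(2) p by auto
  qed
  moreover have "\<epsilon> \<le> \<rho> (Suc k) (act g y') x0" using fs(1) x0_S by blast
  moreover have "far \<epsilon> e' (Suc k) (act g y')" if "e' = e \<or> (\<forall>b\<in>sub e. \<epsilon> \<le> d g b)" for e'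
    using that fs(2,3) by blast
  ultimately show ?case using p by (intro exI[of _ "Suc k"] exI[of _ "act g y'"]) auto
qed

lemma reduced_moves:
  assumes "0 < \<epsilon>" "\<epsilon> \<le> K" "reduced l" "l \<noteq> []" "g \<in> carrier G" "snd ` set l \<subseteq> carrier G"
    "\<And>h e b. h \<in> snd ` set l \<Longrightarrow> h \<notin> sub e \<Longrightarrow> b \<in> sub e \<Longrightarrow> \<epsilon> \<le> d h b"
  shows "\<exists>x. reaches R\<^sub>\<omega> l g x \<and> \<epsilon> \<le> \<rho>\<^sub>\<omega> x x0"
proof -
  obtain n x where "x \<in> S n" "reaches R\<^sub>\<omega> l g x" "\<epsilon> \<le> \<rho> n x x0"
    using reduced_far[OF assms(1,2,3,5,6)] assms(4,7) by meson
  then show ?thesis using \<rho>\<^sub>\<omega>_eq[of x n x0] x0_S by auto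
qed

end

context hnn_base
begin

lemma total_stage_exists:
  obtains S \<rho> R where "stage G d A B \<phi> K S \<rho> R" "\<And>e. Domain (dir e R) = S" "x0 \<in> S"
    "\<And>g h. g \<in> carrier G \<Longrightarrow> h \<in> carrier G \<Longrightarrow> \<rho> (act g x0) (act h x0) = d g h"
    "\<And>\<epsilon> l g. 0 < \<epsilon> \<Longrightarrow> \<epsilon> \<le> K \<Longrightarrow> reduced l \<Longrightarrow> l \<noteq> [] \<Longrightarrow> g \<in> carrier G \<Longrightarrow>
       snd ` set l \<subseteq> carrier G \<Longrightarrow>
       (\<And>h e b. h \<in> snd ` set l \<Longrightarrow> h \<notin> sub e \<Longrightarrow> b \<in> sub e \<Longrightarrow> \<epsilon> \<le> d h b) \<Longrightarrow>
       \<exists>x. reaches R l g x \<and> \<epsilon> \<le> \<rho> x x0"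
proof -
  obtain S \<rho> R where c: "S 0 = {[(0, g)] | g. g \<in> carrier G}"
    "\<rho> 0 = (\<lambda>x y. d (snd (hd x)) (snd (hd y)))" "R 0 = {}"
    "\<And>n. stage G d A B \<phi> K (S n) (\<rho> n) (R n)"
    "\<And>n. steps n (S n) (\<rho> n) (R n) (S (Suc n)) (\<rho> (Suc n)) (R (Suc n))"
    using chain_exists by blast
  interpret stage_chain G d A B \<phi> K S \<rho> R
    by (intro stage_chain.intro stage_chain_axioms.intro hnn_base_axioms c)
  show ?thesis
  proof (rule that[OF limit_stage limit_total])
    show "x0 \<in> S\<^sub>\<omega>" using x0_S by (auto simp: S\<^sub>\<omega>_def)
    show "\<rho>\<^sub>\<omega> (act g x0) (act h x0) = d g h" if "g \<in> carrier G" "h \<in> carrier G" for g h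
      using \<rho>\<^sub>\<omega>_eq[of "act g x0" 0 "act h x0"] that by (simp add: S0 \<rho>0)
  qed (rule reduced_moves)
qed

end

section \<open>Words representing elements of the HNN extension\<close>

type_synonym 'a word = "('a + bool) list"

definition words :: "('a, 'b) monoid_scheme \<Rightarrow> 'a word set" where
  "words G = {w. \<forall>l\<in>set w. case l of Inl g \<Rightarrow> g \<in> carrier G | Inr e \<Rightarrow> True}"

fun letter_inv :: "('a, 'b) monoid_scheme \<Rightarrow> 'a + bool \<Rightarrow> 'a + bool" where
  "letter_inv G (Inl g) = Inl (inv\<^bsub>G\<^esub> g)"
| "letter_inv G (Inr e) = Inr (\<not> e)"

fun letter_val :: "('h, 'c) monoid_scheme \<Rightarrow> ('a \<Rightarrow> 'h) \<Rightarrow> 'h \<Rightarrow> 'a + bool \<Rightarrow> 'h" where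
  "letter_val H \<iota> t (Inl g) = \<iota> g"
| "letter_val H \<iota> t (Inr e) = (if e then t else inv\<^bsub>H\<^esub> t)"

definition word_val :: "('h, 'c) monoid_scheme \<Rightarrow> ('a \<Rightarrow> 'h) \<Rightarrow> 'h \<Rightarrow> 'a word \<Rightarrow> 'h" where
  "word_val H \<iota> t w = foldr (\<lambda>l h. letter_val H \<iota> t l \<otimes>\<^bsub>H\<^esub> h) w \<one>\<^bsub>H\<^esub>"

lemma words_simps [simp]:
  "[] \<in> words G" "Inl g # w \<in> words G \<longleftrightarrow> g \<in> carrier G \<and> w \<in> words G"
  "Inr e # w \<in> words G \<longleftrightarrow> w \<in> words G" "u @ v \<in> words G \<longleftrightarrow> u \<in> words G \<and> v \<in> words G"
  by (auto simp: words_def)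

locale hnn_ext = G: group G + H: group H
  for G :: "'a monoid" and H :: "'h monoid" +
  fixes A :: "'a set" and \<phi> :: "'a \<Rightarrow> 'a" and \<iota> :: "'a \<Rightarrow> 'h" and t :: 'h
  assumes hnn: "is_HNN_extension G A \<phi> H \<iota> t"
    and A_sub: "subgroup A G" and \<phi>_in: "\<And>a. a \<in> A \<Longrightarrow> \<phi> a \<in> carrier G"
begin

lemma \<iota>_hom: "\<iota> \<in> hom G H" and t_carr: "t \<in> carrier H"
  and rel: "a \<in> A \<Longrightarrow> t \<otimes>\<^bsub>H\<^esub> \<iota> a \<otimes>\<^bsub>H\<^esub> inv\<^bsub>H\<^esub> t = \<iota> (\<phi> a)"
  and gen: "generate H (\<iota> ` carrier G \<union> {t}) = carrier H"
  using hnn by (auto simp: is_HNN_extension_def)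

lemma universal:
  fixes Q :: "'a word set monoid"
  assumes "group Q" "f \<in> hom G Q" "s \<in> carrier Q"
    "\<And>a. a \<in> A \<Longrightarrow> s \<otimes>\<^bsub>Q\<^esub> f a \<otimes>\<^bsub>Q\<^esub> inv\<^bsub>Q\<^esub> s = f (\<phi> a)"
  obtains h where "h \<in> hom H Q" "\<And>g. g \<in> carrier G \<Longrightarrow> h (\<iota> g) = f g" "h t = s"
proof -
  have "\<forall>(Q :: 'a word set monoid) f s. group Q \<and> f \<in> hom G Q \<and> s \<in> carrier Q \<and>
      (\<forall>a\<in>A. s \<otimes>\<^bsub>Q\<^esub> f a \<otimes>\<^bsub>Q\<^esub> inv\<^bsub>Q\<^esub> s = f (\<phi> a)) \<longrightarrow>
      (\<exists>h\<in>hom H Q. (\<forall>g\<in>carrier G. h (\<iota> g) = f g) \<and> h t = s)"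
    using hnn unfolding is_HNN_extension_def by (elim conjE)
  from this[THEN spec, THEN spec, THEN spec, of Q f s] show ?thesis using assms that by auto
qed

interpretation \<iota>: group_hom G H \<iota>
  by unfold_locales (rule \<iota>_hom)

abbreviation wval where "wval \<equiv> word_val H \<iota> t"

lemma wval_simps [simp]:
  "wval [] = \<one>\<^bsub>H\<^esub>" "wval (Inl g # w) = \<iota> g \<otimes>\<^bsub>H\<^esub> wval w"
  "wval (Inr True # w) = t \<otimes>\<^bsub>H\<^esub> wval w" "wval (Inr False # w) = inv\<^bsub>H\<^esub> t \<otimes>\<^bsub>H\<^esub> wval w"
  by (simp_all add: word_val_def)

lemma wval_carr: "w \<in> words G \<Longrightarrow> wval w \<in> carrier H"
proof (induction w)
  case (Cons l w)
  show ?case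
  proof (cases l)
    case (Inr e)
    then show ?thesis using Cons t_carr by (cases e) auto
  qed (use Cons in auto)
qed simp

lemma wval_append: "u \<in> words G \<Longrightarrow> v \<in> words G \<Longrightarrow> wval (u @ v) = wval u \<otimes>\<^bsub>H\<^esub> wval v"
proof (induction u)
  case (Cons l u)
  show ?case
  proof (cases l)
    case (Inr e)
    then show ?thesis using Cons t_carr wval_carr by (cases e) (auto simp: H.m_assoc)
  qed (use Cons wval_carr in \<open>auto simp: H.m_assoc\<close>)
qed (simp add: wval_carr)

lemma wval_surj:
  assumes "h \<in> carrier H"
  shows "\<exists>w\<in>words G. wval w = h"
proof -
  have "h \<in> generate H (\<iota> ` carrier G \<union> {t})" using assms gen by simp
  then show ?thesis
  proof (induction rule: generate.induct)
    case one
    show ?case by (rule bexI[of _ "[]"]) auto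
  next
    case (incl h)
    then consider g where "g \<in> carrier G" "h = \<iota> g" | "h = t" by blast
    then show ?case
    proof cases
      case 1 then show ?thesis by (intro bexI[of _ "[Inl g]"]) auto
    next
      case 2 then show ?thesis using t_carr by (intro bexI[of _ "[Inr True]"]) auto
    qed
  next
    case (inv h)
    then consider g where "g \<in> carrier G" "h = \<iota> g" | "h = t" by blast
    then show ?case
    proof cases
      case 1 then show ?thesis by (intro bexI[of _ "[Inl (inv\<^bsub>G\<^esub> g)]"]) auto
    next
      case 2 then show ?thesis using t_carr by (intro bexI[of _ "[Inr False]"]) auto
    qed
  next
    case (eng h1 h2)
    then obtain u v where "u \<in> words G" "v \<in> words G" "wval u = h1" "wval v = h2" by blast
    then show ?case by (intro bexI[of _ "u @ v"]) (auto simp: wval_append)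
  qed
qed

text \<open>The classes of such a congruence form a group of the type admitted in the universal property.\<close>

lemma wval_eq_imp_rel:
  fixes r :: "'a word \<Rightarrow> 'a word \<Rightarrow> bool"
  assumes refl: "\<And>u. u \<in> words G \<Longrightarrow> r u u"
    and sym: "\<And>u v. u \<in> words G \<Longrightarrow> v \<in> words G \<Longrightarrow> r u v \<Longrightarrow> r v u"
    and trans: "\<And>u v w. u \<in> words G \<Longrightarrow> v \<in> words G \<Longrightarrow> w \<in> words G \<Longrightarrow> r u v \<Longrightarrow> r v w \<Longrightarrow> r u w"
    and cong: "\<And>u u' v v'. u \<in> words G \<Longrightarrow> u' \<in> words G \<Longrightarrow> v \<in> words G \<Longrightarrow> v' \<in> words G \<Longrightarrow>
      r u u' \<Longrightarrow> r v v' \<Longrightarrow> r (u @ v) (u' @ v')"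
    and mult: "\<And>g h. g \<in> carrier G \<Longrightarrow> h \<in> carrier G \<Longrightarrow> r [Inl g, Inl h] [Inl (g \<otimes>\<^bsub>G\<^esub> h)]"
    and one: "r [Inl \<one>\<^bsub>G\<^esub>] []"
    and cancel: "\<And>e. r [Inr e, Inr (\<not> e)] []"
    and conj: "\<And>a. a \<in> A \<Longrightarrow> r [Inr True, Inl a, Inr False] [Inl (\<phi> a)]"
    and uv: "u \<in> words G" "v \<in> words G" "wval u = wval v"
  shows "r u v"
proof -
  define cls where "cls u = {v \<in> words G. r u v}" for u
  have cls_eq: "cls u = cls v \<longleftrightarrow> r u v" if "u \<in> words G" "v \<in> words G" for u v
  proof
    assume "cls u = cls v"
    moreover have "v \<in> cls v" using that refl by (simp add: cls_def)
    ultimately have "v \<in> cls u" by simp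
    then show "r u v" by (simp add: cls_def)
  next
    assume "r u v"
    then have "r u w \<longleftrightarrow> r v w" if "w \<in> words G" for w
      using \<open>u \<in> words G\<close> \<open>v \<in> words G\<close> that sym[of u v] trans[of u v w] trans[of v u w] by blast
    then show "cls u = cls v" by (auto simp: cls_def)
  qed
  \<comment> \<open>The elements of \<open>Q\<close> are bare sets of words, so multiplication goes
    through chosen representatives.\<close>
  define rep where "rep c = (SOME w. w \<in> words G \<and> cls w = c)" for c
  have rep: "rep (cls w) \<in> words G" "cls (rep (cls w)) = cls w" if "w \<in> words G" for w
    using someI[of "\<lambda>v. v \<in> words G \<and> cls v = cls w" w] that by (auto simp: rep_def)
  define Q where "Q = \<lparr>carrier = cls ` words G, mult = \<lambda>c c'. cls (rep c @ rep c'), one = cls []\<rparr>"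
  have Q_mult: "cls u \<otimes>\<^bsub>Q\<^esub> cls v = cls (u @ v)" if "u \<in> words G" "v \<in> words G" for u v
  proof -
    have "r (rep (cls u) @ rep (cls v)) (u @ v)"
      using rep that cls_eq by (intro cong) auto
    then show ?thesis using rep that by (simp add: Q_def cls_eq)
  qed
  have Q_one: "\<one>\<^bsub>Q\<^esub> = cls []" by (simp add: Q_def)
  have Q_carr: "carrier Q = cls ` words G" by (simp add: Q_def)
  have inv: "\<exists>v\<in>words G. r (v @ u) []" if "u \<in> words G" for u
    using that
  proof (induction u)
    case Nil
    then show ?case using refl[of "[]"] by (intro bexI[of _ "[]"]) auto
  next
    case (Cons l u)
    define l' where "l' = letter_inv G l"
    have u: "u \<in> words G" using Cons.prems by (cases l) auto
    have l: "[l'] \<in> words G" "[l] \<in> words G" using Cons.prems by (cases l; auto simp: l'_def)+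
    have ll: "r [l', l] []"
    proof (cases l)
      case (Inl g)
      then have g: "g \<in> carrier G" using l by simp
      have "r [Inl (inv\<^bsub>G\<^esub> g), Inl g] [Inl \<one>\<^bsub>G\<^esub>]" using mult[of "inv\<^bsub>G\<^esub> g" g] g by simp
      then show ?thesis
        using trans[of "[Inl (inv\<^bsub>G\<^esub> g), Inl g]" "[Inl \<one>\<^bsub>G\<^esub>]" "[]"] one g Inl by (simp add: l'_def)
    next
      case (Inr e)
      then show ?thesis using cancel[of "\<not> e"] by (simp add: l'_def)
    qed
    obtain v where v: "v \<in> words G" "r (v @ u) []" using Cons.IH[OF u] by blast
    have "r (v @ ([l', l] @ u)) (v @ ([] @ u))"
      using cong[of v v "[l', l] @ u" "[] @ u"] cong[of "[l', l]" "[]" u u] ll refl v u l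
      by (metis append.simps words_simps(1,4))
    then have "r ((v @ [l']) @ l # u) []"
      using trans[of "(v @ [l']) @ l # u" "v @ u" "[]"] v u l
      by (metis append.assoc append.simps words_simps(1,4))
    then show ?case using v l by (intro bexI[of _ "v @ [l']"]) auto
  qed
  have Q: "group Q"
  proof (rule groupI)
    show "\<one>\<^bsub>Q\<^esub> \<in> carrier Q" by (simp add: Q_one Q_carr)
    show "x \<otimes>\<^bsub>Q\<^esub> y \<in> carrier Q" if "x \<in> carrier Q" "y \<in> carrier Q" for x y
      using that Q_mult by (auto simp: Q_carr)
    show "x \<otimes>\<^bsub>Q\<^esub> y \<otimes>\<^bsub>Q\<^esub> z = x \<otimes>\<^bsub>Q\<^esub> (y \<otimes>\<^bsub>Q\<^esub> z)"
      if "x \<in> carrier Q" "y \<in> carrier Q" "z \<in> carrier Q" for x y z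
      using that by (auto simp: Q_carr Q_mult)
    show "\<one>\<^bsub>Q\<^esub> \<otimes>\<^bsub>Q\<^esub> x = x" if "x \<in> carrier Q" for x
      using that by (auto simp: Q_carr Q_mult Q_one)
    show "\<exists>y\<in>carrier Q. y \<otimes>\<^bsub>Q\<^esub> x = \<one>\<^bsub>Q\<^esub>" if x: "x \<in> carrier Q" for x
    proof -
      obtain u where u: "u \<in> words G" "x = cls u" using x by (auto simp: Q_carr)
      obtain v where v: "v \<in> words G" "r (v @ u) []" using inv[OF u(1)] by blast
      have "cls v \<otimes>\<^bsub>Q\<^esub> x = \<one>\<^bsub>Q\<^esub>" using u v by (simp add: Q_mult Q_one cls_eq)
      then show ?thesis using v by (auto simp: Q_carr)
    qed
  qed
  interpret Q: group Q by (rule Q)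
  have f: "(\<lambda>g. cls [Inl g]) \<in> hom G Q"
    using sym[OF _ _ mult] by (auto simp: hom_def Q_carr Q_mult cls_eq)
  have s: "cls [Inr True] \<in> carrier Q" by (simp add: Q_carr)
  have s_inv: "inv\<^bsub>Q\<^esub> cls [Inr True] = cls [Inr False]"
    using cancel[of False] by (intro Q.inv_equality) (auto simp: Q_mult Q_one cls_eq Q_carr)
  have conj_Q: "cls [Inr True] \<otimes>\<^bsub>Q\<^esub> cls [Inl a] \<otimes>\<^bsub>Q\<^esub> inv\<^bsub>Q\<^esub> cls [Inr True] = cls [Inl (\<phi> a)]"
    if "a \<in> A" for a
    using conj[OF that] that \<phi>_in subgroup.mem_carrier[OF A_sub that]
    by (simp add: s_inv Q_mult cls_eq)
  obtain h where h: "h \<in> hom H Q" "\<And>g. g \<in> carrier G \<Longrightarrow> h (\<iota> g) = cls [Inl g]" "h t = cls [Inr True]"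
    using universal[OF Q f s conj_Q] by blast
  interpret h: group_hom H Q h by unfold_locales (rule h)
  \<comment> \<open>The homomorphism given by the universal property sends the value of a word to
    its class, so equal values force equal classes.\<close>
  have hv: "h (wval w) = cls w" if "w \<in> words G" for w
    using that
  proof (induction w)
    case Nil then show ?case by (simp add: Q_one)
  next
    case (Cons l w)
    show ?case
    proof (cases l)
      case (Inl g)
      then show ?thesis using Cons wval_carr h(2) by (simp add: Q_mult)
    next
      case (Inr e)
      then show ?thesis
        using Cons wval_carr h(3) t_carr s_inv by (cases e) (simp_all add: Q_mult)
    qed
  qed
  have "cls u = cls v" using hv[OF uv(1)] hv[OF uv(2)] uv(3) by simp
  then show ?thesis using cls_eq uv by blast
qed

end

section \<open>The metric on the HNN extension\<close>

locale hnn_space = stage G d A B \<phi> K S \<rho> R + hnn_ext G H A \<phi> \<iota> t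
  for G :: "'a monoid" (structure) and d A B \<phi> K S \<rho> R and H :: "'h monoid" and \<iota> t +
  assumes total: "\<And>e. Domain (dir e R) = S"
    and x0_S: "x0 \<in> S"
    and \<rho>_x0: "\<And>g h. g \<in> carrier G \<Longrightarrow> h \<in> carrier G \<Longrightarrow> \<rho> (act g x0) (act h x0) = d g h"
    and moves: "\<And>\<epsilon> l g. 0 < \<epsilon> \<Longrightarrow> \<epsilon> \<le> K \<Longrightarrow> reduced l \<Longrightarrow> l \<noteq> [] \<Longrightarrow> g \<in> carrier G \<Longrightarrow>
      snd ` set l \<subseteq> carrier G \<Longrightarrow>
      (\<And>h e b. h \<in> snd ` set l \<Longrightarrow> h \<notin> sub e \<Longrightarrow> b \<in> sub e \<Longrightarrow> \<epsilon> \<le> d h b) \<Longrightarrow>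
      \<exists>x. reaches R l g x \<and> \<epsilon> \<le> \<rho> x x0"
    and separated: "\<And>h e. h \<in> carrier G \<Longrightarrow> h \<notin> sub e \<Longrightarrow> \<exists>\<epsilon>>0. \<forall>b\<in>sub e. \<epsilon> \<le> d h b"
begin

interpretation \<iota>: group_hom G H \<iota>
  by unfold_locales (rule \<iota>_hom)

text \<open>A choice among values at mutual distance zero. Words therefore act only up to distance
  zero, which \<rho> does not notice.\<close>

definition move :: "bool \<Rightarrow> (nat \<times> 'a) list \<Rightarrow> (nat \<times> 'a) list" where
  "move e x = (SOME y. (x, y) \<in> dir e R)"

primrec wact :: "'a word \<Rightarrow> (nat \<times> 'a) list \<Rightarrow> (nat \<times> 'a) list" where
  "wact [] x = x"
| "wact (l # w) x = (case l of Inl g \<Rightarrow> act g (wact w x) | Inr e \<Rightarrow> move e (wact w x))"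

lemma move_dir: "x \<in> S \<Longrightarrow> (x, move e x) \<in> dir e R"
  unfolding move_def by (rule someI_ex) (use total[of e] in blast)

lemma dir_isom: "(x, y) \<in> dir e R \<Longrightarrow> (x', y') \<in> dir e R \<Longrightarrow> \<rho> x x' = \<rho> y y'"
  using R_isom by (cases e) (auto simp: dir_def dest: R_isom)

lemma dir_S: "(x, y) \<in> dir e R \<Longrightarrow> y \<in> S"
  using R_S by (cases e) (auto simp: dir_def)

lemma move_S: "x \<in> S \<Longrightarrow> move e x \<in> S"
  using move_dir dir_S by blast

lemma \<rho>_move: "x \<in> S \<Longrightarrow> y \<in> S \<Longrightarrow> \<rho> (move e x) (move e y) = \<rho> x y"
  using dir_isom[OF move_dir move_dir] by simp

lemma move_disp: assumes "x \<in> S" shows "\<rho> (move e x) x \<le> K"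
  using move_dir[OF assms, of e] R_K[of x "move e x"] R_K[of "move e x" x]
    \<rho>_sym[OF assms move_S[OF assms, of e]]
  by (cases e) (auto simp: dir_def)

lemma move_move: assumes "x \<in> S" shows "\<rho> (move e (move (\<not> e) x)) x = 0"
proof -
  let ?y = "move (\<not> e) x"
  have "(?y, x) \<in> dir e R" using move_dir[OF assms, of "\<not> e"] by (cases e) (auto simp: dir_def)
  moreover have "(?y, move e ?y) \<in> dir e R" using move_dir move_S assms by blast
  ultimately show ?thesis using dir_isom[of ?y "move e ?y" e ?y x] \<rho>_self move_S assms by simp
qed

lemma \<rho>_zero_cong:
  assumes "x \<in> S" "x' \<in> S" "y \<in> S" "y' \<in> S" "\<rho> x x' = 0" "\<rho> y y' = 0"
  shows "\<rho> x y = \<rho> x' y'"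
  using \<rho>_close[OF assms(1-4)] assms(5,6) by simp

section \<open>The action of words\<close>

lemma wact_S: "w \<in> words G \<Longrightarrow> x \<in> S \<Longrightarrow> wact w x \<in> S"
proof (induction w)
  case (Cons l w)
  then show ?case using act_closed move_S by (cases l) auto
qed simp

lemma \<rho>_wact: "w \<in> words G \<Longrightarrow> x \<in> S \<Longrightarrow> y \<in> S \<Longrightarrow> \<rho> (wact w x) (wact w y) = \<rho> x y"
proof (induction w)
  case (Cons l w)
  then show ?case using \<rho>_act \<rho>_move wact_S by (cases l) auto
qed simp

lemma wact_append: "wact (u @ v) x = wact u (wact v x)"
  by (induction u) (auto split: sum.splits)

text \<open>Makes the supremum in \<open>dist_H\<close> finite: a letter moves every point by at
  most \<open>d g \<one>\<close> or \<open>K\<close>.\<close>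

lemma wact_bounded: "w \<in> words G \<Longrightarrow> \<exists>c. \<forall>x\<in>S. \<rho> (wact w x) x \<le> c"
proof (induction w)
  case Nil
  then show ?case using \<rho>_self by auto
next
  case (Cons l w)
  have w: "w \<in> words G" using Cons.prems by (cases l) auto
  then obtain c where c: "\<And>x. x \<in> S \<Longrightarrow> \<rho> (wact w x) x \<le> c" using Cons.IH by blast
  have "\<rho> (wact (l # w) x) x \<le> (case l of Inl g \<Rightarrow> d g \<one> | Inr e \<Rightarrow> K) + c" if "x \<in> S" for x
  proof -
    have "\<rho> (wact (l # w) x) x \<le> \<rho> (wact (l # w) x) (wact w x) + \<rho> (wact w x) x"
      using \<rho>_tri wact_S[OF Cons.prems that] wact_S[OF w that] that by blast
    moreover have "\<rho> (wact (l # w) x) (wact w x) \<le> (case l of Inl g \<Rightarrow> d g \<one> | Inr e \<Rightarrow> K)"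
      using \<rho>_disp move_disp wact_S[OF w that] Cons.prems by (cases l) auto
    ultimately show ?thesis using c[OF that] by linarith
  qed
  then show ?case by blast
qed

text \<open>Acting equally up to distance zero is a congruence on words that respects the defining
  relations, so by \<open>wval_eq_imp_rel\<close> the action descends to \<open>H\<close>.\<close>

lemma wact_wval:
  assumes "u \<in> words G" "v \<in> words G" "wval u = wval v" "x \<in> S"
  shows "\<rho> (wact u x) (wact v x) = 0"
proof -
  let ?r = "\<lambda>u v. \<forall>x\<in>S. \<rho> (wact u x) (wact v x) = 0"
  have "?r u v"
  proof (rule wval_eq_imp_rel[where r = ?r])
    show "?r u u" if "u \<in> words G" for u using that wact_S \<rho>_self by simp
    show "?r v u" if "u \<in> words G" "v \<in> words G" "?r u v" for u v
      using that wact_S \<rho>_sym by metis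
    show "?r u w" if uvw: "u \<in> words G" "v \<in> words G" "w \<in> words G" "?r u v" "?r v w" for u v w
    proof
      fix x assume x: "x \<in> S"
      show "\<rho> (wact u x) (wact w x) = 0"
        using \<rho>_zero_cong[of "wact u x" "wact v x" "wact w x" "wact w x"] uvw x wact_S \<rho>_self by simp
    qed
    show "?r (u @ v) (u' @ v')"
      if *: "u \<in> words G" "u' \<in> words G" "v \<in> words G" "v' \<in> words G" "?r u u'" "?r v v'" for u u' v v'
    proof
      fix x assume x: "x \<in> S"
      have "\<rho> (wact u (wact v x)) (wact u (wact v' x)) = 0"
        using \<rho>_wact[OF *(1), of "wact v x" "wact v' x"] * x wact_S by simp
      moreover have "\<rho> (wact u (wact v' x)) (wact u' (wact v' x)) = 0" using * x wact_S by simp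
      ultimately show "\<rho> (wact (u @ v) x) (wact (u' @ v') x) = 0"
        using \<rho>_zero_cong[of "wact u (wact v x)" "wact u (wact v' x)" "wact u' (wact v' x)" "wact u' (wact v' x)"]
          * x wact_S \<rho>_self by (simp add: wact_append)
    qed
    show "?r [Inl g, Inl h] [Inl (g \<otimes> h)]" if "g \<in> carrier G" "h \<in> carrier G" for g h
      using that act_mult act_closed \<rho>_self by simp
    show "?r [Inl \<one>] []" using act_one \<rho>_self by simp
    show "?r [Inr e, Inr (\<not> e)] []" for e using move_move by simp
    show "?r [Inr True, Inl a, Inr False] [Inl (\<phi> a)]" if a: "a \<in> A" for a
    proof
      fix x assume x: "x \<in> S"
      let ?y = "act a (move False x)"
      \<comment> \<open>Equivariance applied to the pair \<open>(t^-1 x, x)\<close> yields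
        \<open>t a t^-1 x = \<phi> a x\<close> up to distance zero.\<close>
      have "(move False x, x) \<in> R" using move_dir[OF x, of False] by (simp add: dir_def)
      then have "(?y, act (\<phi> a) x) \<in> dir True R" using R_act a by (simp add: dir_def)
      moreover have y: "?y \<in> S" using move_S x a A_carr act_closed by simp
      ultimately have "\<rho> (move True ?y) (act (\<phi> a) x) = \<rho> ?y ?y"
        using dir_isom[OF move_dir[OF y]] by metis
      then show "\<rho> (wact [Inr True, Inl a, Inr False] x) (wact [Inl (\<phi> a)] x) = 0"
        using \<rho>_self[OF y] by simp
    qed
  qed (use assms in auto)
  then show ?thesis using assms by blast
qed

definition rep :: "'h \<Rightarrow> 'a word" where
  "rep h = (SOME w. w \<in> words G \<and> wval w = h)"

lemma rep: assumes "h \<in> carrier H" shows "rep h \<in> words G" "wval (rep h) = h"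
proof -
  have "\<exists>w. w \<in> words G \<and> wval w = h" using wval_surj[OF assms] by blast
  from someI_ex[OF this] show "rep h \<in> words G" "wval (rep h) = h" by (simp_all add: rep_def)
qed

text \<open>The chosen words do not matter: by \<open>\<rho>_rep\<close> all words for
  \<open>h\<close> and \<open>k\<close> give the same values.\<close>

definition dist_H :: "'h \<Rightarrow> 'h \<Rightarrow> real" where
  "dist_H h k = (SUP x\<in>S. \<rho> (wact (rep h) x) (wact (rep k) x))"

lemma \<rho>_rep:
  assumes "u \<in> words G" "v \<in> words G" "x \<in> S"
  shows "\<rho> (wact (rep (wval u)) x) (wact (rep (wval v)) x) = \<rho> (wact u x) (wact v x)"
  using assms rep[OF wval_carr] wact_wval wact_S by (intro \<rho>_zero_cong) auto

lemma dist_H_ge: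
  assumes "u \<in> words G" "v \<in> words G" "x \<in> S"
  shows "\<rho> (wact u x) (wact v x) \<le> dist_H (wval u) (wval v)"
proof -
  obtain a b where ab: "\<And>x. x \<in> S \<Longrightarrow> \<rho> (wact u x) x \<le> a" "\<And>x. x \<in> S \<Longrightarrow> \<rho> (wact v x) x \<le> b"
    using wact_bounded assms by meson
  have "\<rho> (wact (rep (wval u)) y) (wact (rep (wval v)) y) \<le> a + b" if y: "y \<in> S" for y
  proof -
    have "\<rho> (wact u y) (wact v y) \<le> \<rho> (wact u y) y + \<rho> y (wact v y)"
      using \<rho>_tri wact_S assms y by simp
    then show ?thesis using ab[OF y] \<rho>_sym[OF y, of "wact v y"] wact_S assms y \<rho>_rep by simp
  qed
  then have "bdd_above ((\<lambda>y. \<rho> (wact (rep (wval u)) y) (wact (rep (wval v)) y)) ` S)"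
    by (intro bdd_aboveI2)
  from cSUP_upper[OF assms(3) this] show ?thesis unfolding dist_H_def using \<rho>_rep assms by simp
qed

lemma dist_H_le:
  assumes "u \<in> words G" "v \<in> words G" "\<And>x. x \<in> S \<Longrightarrow> \<rho> (wact u x) (wact v x) \<le> c"
  shows "dist_H (wval u) (wval v) \<le> c"
  unfolding dist_H_def using S_ne assms \<rho>_rep by (intro cSUP_least) auto

lemma carr_word:
  assumes "h \<in> carrier H"
  obtains w where "w \<in> words G" "h = wval w"
  using wval_surj[OF assms] by blast

section \<open>Metric axioms, invariance and restriction to \<open>G\<close>\<close>

lemma dist_H_triangle:
  assumes "h \<in> carrier H" "k \<in> carrier H" "j \<in> carrier H"
  shows "dist_H h j \<le> dist_H h k + dist_H k j"
proof -
  obtain u v w where u: "u \<in> words G" "h = wval u" and v: "v \<in> words G" "k = wval v"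
    and w: "w \<in> words G" "j = wval w" using assms carr_word by metis
  show ?thesis unfolding u(2) v(2) w(2)
  proof (rule dist_H_le[OF u(1) w(1)])
    fix x assume x: "x \<in> S"
    show "\<rho> (wact u x) (wact w x) \<le> dist_H (wval u) (wval v) + dist_H (wval v) (wval w)"
      using \<rho>_tri[of "wact u x" "wact v x" "wact w x"] dist_H_ge[OF u(1) v(1) x]
        dist_H_ge[OF v(1) w(1) x] wact_S u v w x by fastforce
  qed
qed

lemma dist_H_sym:
  assumes "h \<in> carrier H" "k \<in> carrier H"
  shows "dist_H h k = dist_H k h"
  unfolding dist_H_def using assms rep wact_S \<rho>_sym by (intro SUP_cong) auto

lemma dist_H_nonneg:
  assumes "h \<in> carrier H" "k \<in> carrier H"
  shows "0 \<le> dist_H h k"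
proof -
  obtain u v where u: "u \<in> words G" "h = wval u" and v: "v \<in> words G" "k = wval v"
    using assms carr_word by metis
  have "0 \<le> \<rho> (wact u x0) (wact v x0)" using \<rho>_nonneg wact_S u v x0_S by simp
  then show ?thesis using dist_H_ge[OF u(1) v(1) x0_S] u v by simp
qed

lemma dist_H_self: "h \<in> carrier H \<Longrightarrow> dist_H h h = 0"
  using rep wact_S \<rho>_self S_ne by (simp add: dist_H_def)

lemma dist_H_left:
  assumes "g \<in> carrier H" "h \<in> carrier H" "k \<in> carrier H"
  shows "dist_H (g \<otimes>\<^bsub>H\<^esub> h) (g \<otimes>\<^bsub>H\<^esub> k) = dist_H h k"
proof -
  obtain u v w where u: "u \<in> words G" "h = wval u" and v: "v \<in> words G" "k = wval v"
    and w: "w \<in> words G" "g = wval w" using assms carr_word by metis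
  have "\<rho> (wact (w @ u) x) (wact (w @ v) x) = \<rho> (wact u x) (wact v x)" if "x \<in> S" for x
    using \<rho>_wact[OF w(1)] wact_S u v that by (simp add: wact_append)
  then have "dist_H (wval (w @ u)) (wval (w @ v)) = dist_H (wval u) (wval v)"
    using dist_H_le[of "w @ u" "w @ v"] dist_H_le[of u v] dist_H_ge[of "w @ u" "w @ v"]
      dist_H_ge[of u v] u v w by (intro antisym) auto
  then show ?thesis using u v w by (simp add: wval_append)
qed

text \<open>Substitutes \<open>wact w x\<close> for \<open>x\<close>. As \<open>wact w\<close> is
  only known to map \<open>S\<close> into itself, this yields an inequality;
  \<open>dist_H_right\<close> adds the one for the inverse of \<open>g\<close>.\<close>

lemma dist_H_right_le:
  assumes "g \<in> carrier H" "h \<in> carrier H" "k \<in> carrier H"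
  shows "dist_H (h \<otimes>\<^bsub>H\<^esub> g) (k \<otimes>\<^bsub>H\<^esub> g) \<le> dist_H h k"
proof -
  obtain u v w where u: "u \<in> words G" "h = wval u" and v: "v \<in> words G" "k = wval v"
    and w: "w \<in> words G" "g = wval w" using assms carr_word by metis
  have "dist_H (wval (u @ w)) (wval (v @ w)) \<le> dist_H (wval u) (wval v)"
    by (rule dist_H_le) (use u v w dist_H_ge wact_S in \<open>auto simp: wact_append\<close>)
  then show ?thesis using u v w by (simp add: wval_append)
qed

lemma dist_H_right:
  assumes "g \<in> carrier H" "h \<in> carrier H" "k \<in> carrier H"
  shows "dist_H (h \<otimes>\<^bsub>H\<^esub> g) (k \<otimes>\<^bsub>H\<^esub> g) = dist_H h k"
  using dist_H_right_le[OF assms]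
    dist_H_right_le[of "inv\<^bsub>H\<^esub> g" "h \<otimes>\<^bsub>H\<^esub> g" "k \<otimes>\<^bsub>H\<^esub> g"] assms
  by (simp add: H.m_assoc)

text \<open>The supremum is attained at the base point, whose orbit under \<open>G\<close> is an
  isometric copy of \<open>G\<close>.\<close>

lemma dist_H_\<iota>:
  assumes "g \<in> carrier G" "h \<in> carrier G"
  shows "dist_H (\<iota> g) (\<iota> h) = d g h"
proof -
  have w: "[Inl g] \<in> words G" "[Inl h] \<in> words G" "wval [Inl g] = \<iota> g" "wval [Inl h] = \<iota> h"
    using assms by auto
  have "dist_H (\<iota> g) (\<iota> h) \<le> d g h"
    using dist_H_le[OF w(1,2)] w(3,4) \<rho>_act2 assms by simp
  moreover have "d g h \<le> dist_H (\<iota> g) (\<iota> h)"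
    using dist_H_ge[OF w(1,2) x0_S] w(3,4) \<rho>_x0 assms by simp
  ultimately show ?thesis by simp
qed

section \<open>Reduced words for the elements of \<open>H\<close>\<close>

primrec alt_word :: "(bool \<times> 'a) list \<Rightarrow> 'a \<Rightarrow> 'a word" where
  "alt_word [] g = [Inl g]"
| "alt_word (p # l) g = Inl g # Inr (fst p) # alt_word l (snd p)"

lemma alt_word_words:
  "g \<in> carrier G \<Longrightarrow> snd ` set l \<subseteq> carrier G \<Longrightarrow> alt_word l g \<in> words G"
  by (induction l arbitrary: g) auto

lemma alt_word_mult:
  assumes "g \<in> carrier G" "h \<in> carrier G" "snd ` set l \<subseteq> carrier G"
  shows "wval (alt_word l (g \<otimes> h)) = \<iota> g \<otimes>\<^bsub>H\<^esub> wval (alt_word l h)"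
proof (cases l)
  case (Cons p l')
  have "Inr (fst p) # alt_word l' (snd p) \<in> words G"
    using alt_word_words assms Cons by simp
  from wval_carr[OF this] show ?thesis using assms Cons by (simp add: H.m_assoc)
qed (use assms in simp)

lemma alt_word_exists:
  "w \<in> words G \<Longrightarrow> \<exists>l g. g \<in> carrier G \<and> snd ` set l \<subseteq> carrier G \<and> wval (alt_word l g) = wval w"
proof (induction w)
  case Nil
  show ?case by (intro exI[of _ "[]"] exI[of _ \<one>]) simp
next
  case (Cons s w)
  have w: "w \<in> words G" using Cons.prems by (cases s) auto
  then obtain l g where lg: "g \<in> carrier G" "snd ` set l \<subseteq> carrier G" "wval (alt_word l g) = wval w"
    using Cons.IH by blast
  show ?case
  proof (cases s)
    case (Inl h)
    then show ?thesis using Cons.prems lg alt_word_mult[of h g l]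
      by (intro exI[of _ l] exI[of _ "h \<otimes> g"]) auto
  next
    case (Inr e)
    have "wval (alt_word ((e, g) # l) \<one>) = wval (s # w)"
      using Inr lg t_carr wval_carr[OF w] by (cases e) auto
    then show ?thesis using lg by (intro exI[of _ "(e, g) # l"] exI[of _ \<one>]) auto
  qed
qed

definition tpow :: "bool \<Rightarrow> 'h" where "tpow e = (if e then t else inv\<^bsub>H\<^esub> t)"

lemma tpow_carr: "tpow e \<in> carrier H" and wval_Inr: "wval (Inr e # w) = tpow e \<otimes>\<^bsub>H\<^esub> wval w"
  using t_carr by (cases e; simp add: tpow_def)+

lemma tpow_conj:
  assumes "g \<in> sub (\<not> e)"
  shows "\<exists>g'\<in>carrier G. tpow e \<otimes>\<^bsub>H\<^esub> \<iota> g \<otimes>\<^bsub>H\<^esub> tpow (\<not> e) = \<iota> g'"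
proof (cases e)
  case True
  then show ?thesis using assms rel \<phi>_carr by (auto simp: sub_def tpow_def)
next
  case False
  then obtain a where a: "a \<in> A" "g = \<phi> a" using assms bij by (auto simp: sub_def bij_betw_def)
  have "inv\<^bsub>H\<^esub> t \<otimes>\<^bsub>H\<^esub> (t \<otimes>\<^bsub>H\<^esub> \<iota> a \<otimes>\<^bsub>H\<^esub> inv\<^bsub>H\<^esub> t) \<otimes>\<^bsub>H\<^esub> t = \<iota> a"
    using t_carr \<iota>.hom_closed[OF A_carr[OF a(1)]]
    by (simp add: H.m_assoc) (simp flip: H.m_assoc)
  then show ?thesis using a rel[OF a(1)] A_carr False by (auto simp: tpow_def)
qed

text \<open>A pinch collapses to an element of \<open>G\<close> that merges with the neighbouring
  coefficients, which removes two entries. A pinch further right is left to the induction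
  hypothesis.\<close>

lemma not_reduced_shorten:
  "\<not> reduced l \<Longrightarrow> g \<in> carrier G \<Longrightarrow> snd ` set l \<subseteq> carrier G \<Longrightarrow>
    \<exists>l' g'. length l' < length l \<and> g' \<in> carrier G \<and> snd ` set l' \<subseteq> carrier G \<and>
      wval (alt_word l' g') = wval (alt_word l g)"
proof (induction l arbitrary: g rule: reduced.induct)
  case (1 e h e' k l)
  have c: "h \<in> carrier G" "k \<in> carrier G" "snd ` set l \<subseteq> carrier G" using "1.prems" by auto
  have W: "wval (alt_word l k) \<in> carrier H" using alt_word_words c wval_carr by blast
  show ?case
  proof (cases "e \<noteq> e' \<and> h \<in> sub e'")
    case True
    then have "h \<in> sub (\<not> e)" "e' = (\<not> e)" by auto
    then obtain g' where g': "g' \<in> carrier G" "tpow e \<otimes>\<^bsub>H\<^esub> \<iota> h \<otimes>\<^bsub>H\<^esub> tpow e' = \<iota> g'"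
      using tpow_conj by blast
    have "wval (alt_word ((e, h) # (e', k) # l) g) =
        \<iota> g \<otimes>\<^bsub>H\<^esub> (tpow e \<otimes>\<^bsub>H\<^esub> (\<iota> h \<otimes>\<^bsub>H\<^esub> (tpow e' \<otimes>\<^bsub>H\<^esub> wval (alt_word l k))))"
      by (simp add: wval_Inr)
    also have "\<dots> = \<iota> g \<otimes>\<^bsub>H\<^esub> ((tpow e \<otimes>\<^bsub>H\<^esub> \<iota> h \<otimes>\<^bsub>H\<^esub> tpow e') \<otimes>\<^bsub>H\<^esub> wval (alt_word l k))"
      using W tpow_carr c by (simp add: H.m_assoc)
    also have "\<dots> = wval (alt_word l (g \<otimes> (g' \<otimes> k)))"
      using g' alt_word_mult c "1.prems" by simp
    finally show ?thesis using g' c "1.prems"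
      by (intro exI[of _ l] exI[of _ "g \<otimes> (g' \<otimes> k)"]) auto
  next
    case False
    then have "\<not> reduced ((e', k) # l)" using "1.prems" by auto
    then obtain l' g' where l': "length l' < length ((e', k) # l)" "g' \<in> carrier G"
      "snd ` set l' \<subseteq> carrier G" "wval (alt_word l' g') = wval (alt_word ((e', k) # l) h)"
      using "1.IH"[of h] "1.prems" by auto
    have "wval (alt_word ((e, g') # l') g) = wval (alt_word ((e, h) # (e', k) # l) g)"
      using l'(4) by (simp add: wval_Inr)
    then show ?thesis using l' "1.prems" by (intro exI[of _ "(e, g') # l'"] exI[of _ g]) auto
  qed
qed auto

text \<open>A representing list of least length is reduced. That nonempty reduced words are
  nontrivial comes afterwards from the metric, not from a normal form theorem.\<close>

lemma reduced_word_exists: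
  assumes "h \<in> carrier H"
  obtains l g where "reduced l" "g \<in> carrier G" "snd ` set l \<subseteq> carrier G" "wval (alt_word l g) = h"
proof -
  define P where "P l \<longleftrightarrow> (\<exists>g. g \<in> carrier G \<and> snd ` set l \<subseteq> carrier G \<and> wval (alt_word l g) = h)" for l
  have "\<exists>l. P l" using alt_word_exists wval_surj[OF assms] unfolding P_def by metis
  then obtain l where l: "P l" "\<And>l'. P l' \<Longrightarrow> length l \<le> length l'"
    using arg_min_nat_lemma[of P _ length] by blast
  then obtain g where g: "g \<in> carrier G" "snd ` set l \<subseteq> carrier G" "wval (alt_word l g) = h"
    by (auto simp: P_def)
  have "reduced l"
  proof (rule ccontr)
    assume "\<not> reduced l"
    then obtain l' where "length l' < length l" "P l'"
      using not_reduced_shorten g unfolding P_def by metis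
    then show False using l(2) by fastforce
  qed
  then show ?thesis using that g by blast
qed

lemma reaches_wact:
  assumes "g \<in> carrier G" "snd ` set l \<subseteq> carrier G" "reaches R l g x"
  shows "x \<in> S \<and> \<rho> x (wact (alt_word l g) x0) = 0"
  using assms
proof (induction l arbitrary: g x)
  case Nil
  then show ?case using act_closed[OF _ x0_S, of g] \<rho>_self[of "act g x0"] by simp
next
  case (Cons p l)
  obtain y y' where y: "reaches R l (snd p) y" "(y, y') \<in> dir (fst p) R" "x = act g y'"
    using Cons.prems by auto
  let ?z = "wact (alt_word l (snd p)) x0"
  have z: "y \<in> S" "\<rho> y ?z = 0" using Cons.IH[OF _ _ y(1)] Cons.prems by auto
  have zS: "?z \<in> S" using wact_S alt_word_words x0_S Cons.prems by simp
  have "\<rho> y' (move (fst p) ?z) = 0" using dir_isom[OF y(2) move_dir[OF zS]] z by simp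
  then show ?case using y dir_S[OF y(2)] \<rho>_act act_closed move_S[OF zS] Cons.prems by simp
qed

text \<open>Finitely many coefficients and two subgroups leave a common positive bound; capping it
  by \<open>K\<close> makes \<open>moves\<close> applicable.\<close>

lemma separated_list:
  assumes "snd ` set l \<subseteq> carrier G"
  obtains \<epsilon> where "0 < \<epsilon>" "\<epsilon> \<le> K" "\<And>h e b. h \<in> snd ` set l \<Longrightarrow> h \<notin> sub e \<Longrightarrow> b \<in> sub e \<Longrightarrow> \<epsilon> \<le> d h b"
proof -
  have one: "\<exists>\<epsilon>>0. \<forall>e. h \<notin> sub e \<longrightarrow> (\<forall>b\<in>sub e. \<epsilon> \<le> d h b)" if h: "h \<in> carrier G" for h
  proof -
    have "\<exists>\<epsilon>>0. h \<notin> sub e \<longrightarrow> (\<forall>b\<in>sub e. \<epsilon> \<le> d h b)" for e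
      using separated[OF h, of e] by (cases "h \<in> sub e") (auto intro: exI[of _ 1])
    then obtain f where f: "\<And>e. 0 < f e" "\<And>e. h \<notin> sub e \<longrightarrow> (\<forall>b\<in>sub e. f e \<le> d h b)" by metis
    have "min (f True) (f False) \<le> f e" for e by (cases e) auto
    then show ?thesis
      using f by (intro exI[of _ "min (f True) (f False)"]) (force intro: order_trans)
  qed
  have "\<exists>\<epsilon>>0. \<epsilon> \<le> K \<and> (\<forall>h e b. h \<in> F \<longrightarrow> h \<notin> sub e \<longrightarrow> b \<in> sub e \<longrightarrow> \<epsilon> \<le> d h b)"
    if "finite F" "F \<subseteq> carrier G" for F
    using that
  proof (induction F)
    case empty
    then show ?case using K_pos by auto
  next
    case (insert x F)
    then obtain \<epsilon> where \<epsilon>: "0 < \<epsilon>" "\<epsilon> \<le> K"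
      "\<And>h e b. h \<in> F \<Longrightarrow> h \<notin> sub e \<Longrightarrow> b \<in> sub e \<Longrightarrow> \<epsilon> \<le> d h b" by auto
    obtain \<delta> where \<delta>: "0 < \<delta>" "\<And>e b. x \<notin> sub e \<Longrightarrow> b \<in> sub e \<Longrightarrow> \<delta> \<le> d x b"
      using one[of x] insert.prems by auto
    have "min \<epsilon> \<delta> \<le> d h b" if "h \<in> insert x F" "h \<notin> sub e" "b \<in> sub e" for h e b
      using that \<epsilon>(3)[of h e b] \<delta>(2)[of e b] by auto
    then show ?case using \<epsilon> \<delta> by (intro exI[of _ "min \<epsilon> \<delta>"]) auto
  qed
  from this[of "snd ` set l"] show ?thesis using assms that by auto
qed

lemma dist_H_reduced:
  assumes "0 < \<epsilon>" "\<epsilon> \<le> K" "reduced l" "l \<noteq> []" "g \<in> carrier G" "snd ` set l \<subseteq> carrier G"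
    "\<And>h e b. h \<in> snd ` set l \<Longrightarrow> h \<notin> sub e \<Longrightarrow> b \<in> sub e \<Longrightarrow> \<epsilon> \<le> d h b"
  shows "\<epsilon> \<le> dist_H (wval (alt_word l g)) \<one>\<^bsub>H\<^esub>"
proof -
  obtain x where x: "reaches R l g x" "\<epsilon> \<le> \<rho> x x0"
    using moves[OF assms(1-6)] assms(7) by meson
  have w: "alt_word l g \<in> words G" using alt_word_words assms by blast
  have "\<rho> x x0 = \<rho> (wact (alt_word l g) x0) (wact [] x0)"
    using reaches_wact[OF assms(5,6) x(1)] wact_S[OF w x0_S] x0_S \<rho>_self
    by (intro \<rho>_zero_cong) auto
  also have "\<dots> \<le> dist_H (wval (alt_word l g)) (wval [])"
    using dist_H_ge[OF w _ x0_S, of "[]"] by simp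
  finally show ?thesis using x by simp
qed

lemma dist_H_pos:
  assumes "h \<in> carrier H" "h \<noteq> \<one>\<^bsub>H\<^esub>"
  shows "0 < dist_H h \<one>\<^bsub>H\<^esub>"
proof -
  obtain l g where lg: "reduced l" "g \<in> carrier G" "snd ` set l \<subseteq> carrier G" "wval (alt_word l g) = h"
    using reduced_word_exists[OF assms(1)] by blast
  show ?thesis
  proof (cases "l = []")
    case True
    then have "h = \<iota> g" using lg by simp
    moreover have "g \<noteq> \<one>" using calculation assms by auto
    then have "d g \<one> \<noteq> 0" using MS lg by (simp add: Metric_space_def)
    ultimately show ?thesis using dist_H_\<iota>[of g \<one>] d_nonneg[of g \<one>] lg by simp
  next
    case False
    obtain \<epsilon> where "0 < \<epsilon>" "\<epsilon> \<le> K"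
      "\<And>h e b. h \<in> snd ` set l \<Longrightarrow> h \<notin> sub e \<Longrightarrow> b \<in> sub e \<Longrightarrow> \<epsilon> \<le> d h b"
      using separated_list[OF lg(3)] by blast
    then show ?thesis using dist_H_reduced[of \<epsilon> l g] lg False by fastforce
  qed
qed

lemma dist_H_t: "dist_H t \<one>\<^bsub>H\<^esub> = K"
proof (rule antisym)
  show "dist_H t \<one>\<^bsub>H\<^esub> \<le> K"
    using dist_H_le[of "[Inr True]" "[]" K] move_disp t_carr by simp
  \<comment> \<open>The coefficients of the word \<open>t\<close> are \<open>\<one>\<close>, which
    lies in both subgroups. The separation condition is thus vacuous and \<epsilon> can be taken to
    be \<open>K\<close>.\<close>
  have "\<one> \<in> sub e" for e
    using subA subB subgroup.one_closed by (auto simp: sub_def)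
  then have "K \<le> dist_H (wval (alt_word [(True, \<one>)] \<one>)) \<one>\<^bsub>H\<^esub>"
    using K_pos by (intro dist_H_reduced) auto
  then show "K \<le> dist_H t \<one>\<^bsub>H\<^esub>" using t_carr by simp
qed

lemma dist_H_zero:
  assumes "h \<in> carrier H" "k \<in> carrier H" "dist_H h k = 0"
  shows "h = k"
proof (rule ccontr)
  assume "h \<noteq> k"
  then have "inv\<^bsub>H\<^esub> k \<otimes>\<^bsub>H\<^esub> h \<noteq> \<one>\<^bsub>H\<^esub>" using assms H.inv_equality[of "inv\<^bsub>H\<^esub> k" h] by auto
  then have "0 < dist_H (inv\<^bsub>H\<^esub> k \<otimes>\<^bsub>H\<^esub> h) \<one>\<^bsub>H\<^esub>" using dist_H_pos assms by simp
  then show False using dist_H_left[of "inv\<^bsub>H\<^esub> k" h k] assms by simp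
qed

lemma biinv_metric_exists:
  "\<exists>d'. biinv_metric H d' \<and> (\<forall>g\<in>carrier G. \<forall>h\<in>carrier G. d' (\<iota> g) (\<iota> h) = d g h) \<and> d' t \<one>\<^bsub>H\<^esub> = K"
proof -
  \<comment> \<open>Metric_space demands symmetry and nonnegativity off the carrier as well.\<close>
  define d' where "d' h k = (if h \<in> carrier H \<and> k \<in> carrier H then dist_H h k else 0)" for h k
  have "Metric_space (carrier H) d'"
    using dist_H_nonneg dist_H_sym dist_H_self dist_H_zero dist_H_triangle
    by unfold_locales (auto simp: d'_def)
  then have "biinv_metric H d'"
    using dist_H_left dist_H_right by (simp add: biinv_metric_def d'_def)
  moreover have "d' (\<iota> g) (\<iota> h) = d g h" if "g \<in> carrier G" "h \<in> carrier G" for g h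
    using that dist_H_\<iota> by (simp add: d'_def)
  moreover have "d' t \<one>\<^bsub>H\<^esub> = K" using dist_H_t t_carr by (simp add: d'_def)
  ultimately show ?thesis by blast
qed

end

text \<open>The form in which closedness of \<open>A\<close> and \<open>B\<close> enters the
  estimates for reduced words.\<close>

lemma closedin_separated:
  assumes "Metric_space M d" "closedin (Metric_space.mtopology M d) A" "x \<in> M" "x \<notin> A"
  shows "\<exists>\<epsilon>>0. \<forall>a\<in>A. \<epsilon> \<le> d x a"
proof -
  interpret Metric_space M d by (rule assms)
  have A: "A \<subseteq> M" using closedin_subset[OF assms(2)] by simp
  have "openin mtopology (M - A)" using assms(2) by (simp add: closedin_def)
  then obtain r where r: "r > 0" "mball x r \<subseteq> M - A"
    using assms by (auto simp: openin_mtopology)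
  have "r \<le> d x a" if "a \<in> A" for a
    using r(2) that A assms(3) by (fastforce simp: in_mball)
  then show ?thesis using r by blast
qed

theorem mainTheorem12:
  fixes G :: "'a monoid" and d :: "'a \<Rightarrow> 'a \<Rightarrow> real"
    and A B :: "'a set" and \<phi> :: "'a \<Rightarrow> 'a"
    and H :: "'h monoid" and \<iota> :: "'a \<Rightarrow> 'h" and t :: 'h and K :: real
  assumes "group G"
    and "biinv_metric G d"
    and "subgroup A G" and "subgroup B G"
    and "closedin (Metric_space.mtopology (carrier G) d) A"
    and "closedin (Metric_space.mtopology (carrier G) d) B"
    and "\<phi> \<in> iso (G\<lparr>carrier := A\<rparr>) (G\<lparr>carrier := B\<rparr>)"
    and "\<forall>a1\<in>A. \<forall>a2\<in>A. d (\<phi> a1) (\<phi> a2) = d a1 a2"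
    and "is_HNN_extension G A \<phi> H \<iota> t"
    and "K > 0"
    and "diam_d d A \<le> ereal K"
  shows "\<exists>d'. biinv_metric H d' \<and>
           (\<forall>g1\<in>carrier G. \<forall>g2\<in>carrier G. d' (\<iota> g1) (\<iota> g2) = d g1 g2) \<and>
           d' t \<one>\<^bsub>H\<^esub> = K"
proof -
  have oneA: "\<one>\<^bsub>G\<^esub> \<in> A" using assms(3) subgroup.one_closed by blast
  have bound: "d a \<one>\<^bsub>G\<^esub> \<le> K" if "a \<in> A" for a
  proof -
    have "ereal (d a \<one>\<^bsub>G\<^esub>) \<le> diam_d d A"
      unfolding diam_d_def using that oneA by (intro SUP_upper2[of "(a, \<one>\<^bsub>G\<^esub>)"]) auto
    then show ?thesis using assms(11) by (metis ereal_less_eq(3) order_trans)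
  qed
  interpret b: hnn_base G d A B \<phi> K
    using assms bound
    by (intro hnn_base.intro hnn_base_axioms.intro) (auto simp: iso_def hom_def)
  have H: "group H" using assms(9) by (simp add: is_HNN_extension_def)
  show ?thesis
  proof (rule b.total_stage_exists)
    fix S \<rho> R
    assume st: "stage G d A B \<phi> K S \<rho> R" "\<And>e. Domain (dir e R) = S" "b.x0 \<in> S"
      "\<And>g h. g \<in> carrier G \<Longrightarrow> h \<in> carrier G \<Longrightarrow> \<rho> (b.act g b.x0) (b.act h b.x0) = d g h"
      "\<And>\<epsilon> l g. 0 < \<epsilon> \<Longrightarrow> \<epsilon> \<le> K \<Longrightarrow> b.reduced l \<Longrightarrow> l \<noteq> [] \<Longrightarrow> g \<in> carrier G \<Longrightarrow>
         snd ` set l \<subseteq> carrier G \<Longrightarrow>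
         (\<And>h e b. h \<in> snd ` set l \<Longrightarrow> h \<notin> b.sub e \<Longrightarrow> b \<in> b.sub e \<Longrightarrow> \<epsilon> \<le> d h b) \<Longrightarrow>
         \<exists>x. b.reaches R l g x \<and> \<epsilon> \<le> \<rho> x b.x0"
    interpret hnn_space G d A B \<phi> K S \<rho> R H \<iota> t
    proof (intro hnn_space.intro hnn_space_axioms.intro hnn_ext.intro hnn_ext_axioms.intro st assms(1) H)
      show "\<exists>\<epsilon>>0. \<forall>b\<in>b.sub e. \<epsilon> \<le> d h b" if "h \<in> carrier G" "h \<notin> b.sub e" for h e
        using closedin_separated[OF b.MS] assms(5,6) that by (cases e) (auto simp: b.sub_def)
    qed (use assms b.\<phi>_carr in auto)
    show ?thesis by (rule biinv_metric_exists)
  qed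
qed

end
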